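(* There exist constants $c_1, c_2>0$ and a positive integer $w_0$ such that for every integer $w\ge w_0$, $$c_1\, w^{1/3}\le \log \kappa(2,w)\le c_2\, w^{1/3},$$ where $\kappa(2,w)$ is the number of equivalence classes of two-dimensional convex lattice polygons containing exactly $w$ lattice points.
   Context: A convex lattice polytope in $\mathbb{E}^d$ is the convex hull of a finite subset of the integer lattice $\mathbb{Z}^d$; it is called $d$-dimensional if it has non-empty interior (a polygon when $d=2$). Let $|P|$ denote the cardinality of $P\cap\mathbb{Z}^d$. Two $d$-dimensional convex lattice polytopes $P_1,P_2$ are equivalent if there is an affine transformation $\sigma$ of $\mathbb{E}^d$ with $\sigma(\mathbb{Z}^d)=\mathbb{Z}^d$ and $\sigma(P_1)=P_2$. $\kappa(d,w)$ denotes the number of equivalence classes of $d$-dimensional convex lattice polytopes $P$ with $|P|=w$. *)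

theory Defs
  imports "HOL-Analysis.Analysis"
begin

definition int_lattice :: "(real ^ 'n) set" where
  "int_lattice = {x. \<forall>i. x $ i \<in> \<int>}"

definition lattice_polytope :: "(real ^ 'n) set \<Rightarrow> bool" where
  "lattice_polytope P \<longleftrightarrow> (\<exists>S. finite S \<and> S \<subseteq> int_lattice \<and> P = convex hull S)"

definition full_dimensional :: "(real ^ 'n) set \<Rightarrow> bool" where
  "full_dimensional P \<longleftrightarrow> interior P \<noteq> {}"

text \<open>A lattice polytope is bounded, so the set below is finite and \<^const>\<open>card\<close> is its
  true cardinality.\<close>

definition lattice_count :: "(real ^ 'n) set \<Rightarrow> nat" where
  "lattice_count P = card (P \<inter> int_lattice)"

definition affine_transformation :: "(real ^ 'n \<Rightarrow> real ^ 'n) \<Rightarrow> bool" where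
  "affine_transformation \<sigma> \<longleftrightarrow>
     (\<exists>(A :: real ^ 'n ^ 'n) b. invertible A \<and> \<sigma> = (\<lambda>x. A *v x + b))"

definition lattice_equivalent :: "(real ^ 'n) set \<Rightarrow> (real ^ 'n) set \<Rightarrow> bool" where
  "lattice_equivalent P Q \<longleftrightarrow>
     (\<exists>\<sigma>. affine_transformation \<sigma> \<and> \<sigma> ` int_lattice = int_lattice \<and> \<sigma> ` P = Q)"

definition polytopes_with_count :: "nat \<Rightarrow> (real ^ 'n) set set" where
  "polytopes_with_count w =
     {P. lattice_polytope P \<and> full_dimensional P \<and> lattice_count P = w}"

definition equivalence_rel :: "nat \<Rightarrow> ((real ^ 'n) set \<times> (real ^ 'n) set) set" where
  "equivalence_rel w =
     {(P, Q). P \<in> polytopes_with_count w \<and> Q \<in> polytopes_with_count w \<and>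
              lattice_equivalent P Q}"

text \<open>The dimension \<open>d\<close> is \<open>CARD('n)\<close>, so \<open>\<kappa>(2, w)\<close> is \<open>kappa TYPE(2) w\<close>.
  Because \<^const>\<open>card\<close> of an infinite set is 0, this agrees with the number of classes only
  where that number is finite. For \<open>d \<ge> 3\<close> it can be infinite (Reeve tetrahedra have 4 lattice
  points); for \<open>d = 2\<close> it is always finite. A positive lower bound on \<open>ln (kappa TYPE('n) w)\<close>
  entails finiteness, since \<open>ln 0 = 0\<close>.\<close>

definition kappa :: "'n::finite itself \<Rightarrow> nat \<Rightarrow> nat" where
  "kappa _ w =
     card ((polytopes_with_count w :: (real ^ 'n) set set) // equivalence_rel w)"

lemma affine_transformation_id: "affine_transformation (\<lambda>x. x)"
  unfolding affine_transformation_def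
  by (rule exI[of _ "mat 1"], rule exI[of _ 0])
     (auto simp: invertible_def intro!: exI[of _ "mat 1"])

lemma affine_transformation_comp:
  assumes "affine_transformation \<sigma>" "affine_transformation \<tau>"
  shows "affine_transformation (\<tau> \<circ> \<sigma>)"
proof -
  from assms obtain A a B b where
    A: "invertible A" "\<sigma> = (\<lambda>x. A *v x + a)" and B: "invertible B" "\<tau> = (\<lambda>x. B *v x + b)"
    unfolding affine_transformation_def by blast
  have "\<tau> \<circ> \<sigma> = (\<lambda>x. (B ** A) *v x + (B *v a + b))"
    by (simp add: A B fun_eq_iff matrix_vector_right_distrib matrix_vector_mul_assoc add.assoc)
  then show ?thesis
    unfolding affine_transformation_def using invertible_mult[OF B(1) A(1)] by blast
qed

lemma affine_transformation_inverse:
  assumes "affine_transformation \<sigma>"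
  obtains \<tau> where "affine_transformation \<tau>" "\<tau> \<circ> \<sigma> = id"
proof -
  from assms obtain A a where A: "invertible A" "\<sigma> = (\<lambda>x. A *v x + a)"
    unfolding affine_transformation_def by blast
  from A(1) obtain B where B: "A ** B = mat 1" "B ** A = mat 1"
    unfolding invertible_def by blast
  let ?\<tau> = "\<lambda>x. B *v x + (- (B *v a))"
  have "affine_transformation ?\<tau>"
    unfolding affine_transformation_def using B invertible_def by blast
  moreover have "?\<tau> \<circ> \<sigma> = id"
    by (simp add: A fun_eq_iff matrix_vector_right_distrib matrix_vector_mul_assoc B)
  ultimately show ?thesis by (rule that)
qed

lemma lattice_equivalent_refl: "lattice_equivalent P P"
  unfolding lattice_equivalent_def
  by (rule exI[of _ "\<lambda>x. x"]) (simp add: affine_transformation_id)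

lemma lattice_equivalent_sym:
  assumes "lattice_equivalent P Q"
  shows "lattice_equivalent Q P"
proof -
  from assms obtain \<sigma> where \<sigma>: "affine_transformation \<sigma>" "\<sigma> ` int_lattice = int_lattice" "\<sigma> ` P = Q"
    unfolding lattice_equivalent_def by blast
  from affine_transformation_inverse[OF \<sigma>(1)] obtain \<tau>
    where \<tau>: "affine_transformation \<tau>" "\<tau> \<circ> \<sigma> = id" .
  have "\<tau> ` \<sigma> ` X = X" for X
    using \<tau>(2) by (simp add: image_comp)
  then show ?thesis
    unfolding lattice_equivalent_def using \<sigma> \<tau>(1) by metis
qed

lemma lattice_equivalent_trans:
  assumes "lattice_equivalent P Q" "lattice_equivalent Q R"
  shows "lattice_equivalent P R"
proof -
  from assms obtain \<sigma> \<tau> where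
    "affine_transformation \<sigma>" "\<sigma> ` int_lattice = int_lattice" "\<sigma> ` P = Q"
    "affine_transformation \<tau>" "\<tau> ` int_lattice = int_lattice" "\<tau> ` Q = R"
    unfolding lattice_equivalent_def by blast
  then show ?thesis
    unfolding lattice_equivalent_def
    by (intro exI[of _ "\<tau> \<circ> \<sigma>"]) (simp only: affine_transformation_comp image_comp[symmetric] simp_thms)
qed

lemma equiv_equivalence_rel: "equiv (polytopes_with_count w) (equivalence_rel w)"
  unfolding equivalence_rel_def
  by (intro equivI refl_onI symI transI)
     (auto intro: lattice_equivalent_refl lattice_equivalent_sym lattice_equivalent_trans)

end

theory Submission
  imports Defs "HOL-Real_Asymp.Real_Asymp"
begin

text \<open>Upper bound: every class has a representative in a box of sides \<open>a \<le> b\<close> with \<open>a * b = O(w)\<close>.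
  Its vertices split into an upper and a lower chain; a chain is determined by its first point
  and the set of its edge vectors, because the slopes strictly decrease. Giving the vector \<open>(x, y)\<close> the
  weight \<open>exp (- s * x - t * \<bar>y\<bar>)\<close>, with \<open>s\<close> and \<open>t\<close> adapted to the box, shows that there are only
  \<open>exp (O(w powr (1/3)))\<close> such sets.

  Lower bound: the points \<open>(i, i\<^sup>2)\<close> with \<open>1 \<le> i \<le> 2 * k\<close> and \<open>k\<close> about \<open>w powr (1/3) / 4\<close> are vertices
  of a lattice polygon with exactly \<open>w + k\<close> lattice points. Removing any \<open>k\<close> of them leaves the lattice
  points of a polygon with \<open>w\<close> lattice points, and each class contains at most \<open>(w + k) ^ 3\<close>
  of the \<open>2 * k choose k\<close> polygons obtained in this way.\<close>

section \<open>Lattice points and unimodular maps\<close>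

definition emb :: "int \<times> int \<Rightarrow> real ^ 2" where
  "emb p = vector [of_int (fst p), of_int (snd p)]"

lemma emb_nth [simp]: "emb p $ 1 = of_int (fst p)" "emb p $ 2 = of_int (snd p)"
  by (simp_all add: emb_def)

lemma inj_emb: "inj emb"
  by (rule injI) (metis emb_nth of_int_eq_iff prod_eq_iff)

lemma int_lattice_eq: "(int_lattice :: (real ^ 2) set) = range emb"
proof (intro equalityI subsetI)
  fix x :: "real ^ 2" assume "x \<in> int_lattice"
  then have "x $ 1 \<in> \<int>" "x $ 2 \<in> \<int>" by (auto simp: int_lattice_def)
  then obtain a b where "x $ 1 = of_int a" "x $ 2 = of_int b"
    by (metis Ints_cases)
  then have "x = emb (a, b)"
    by (simp add: vec_eq_iff forall_2)
  then show "x \<in> range emb" by blast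
qed (auto simp: int_lattice_def forall_2)

text \<open>Pairs of integers instead of vectors: counting, \<open>Min\<close>, \<open>Max\<close>
  and integrality arguments then take place in \<open>int\<close>.\<close>

definition latt :: "(real ^ 2) set \<Rightarrow> (int \<times> int) set" where
  "latt P = {p. emb p \<in> P}"

lemma Int_int_lattice: "P \<inter> int_lattice = emb ` latt P"
  by (auto simp: latt_def int_lattice_eq)

lemma lattice_count_eq: "lattice_count P = card (latt P)"
  by (simp add: lattice_count_def Int_int_lattice card_image inj_on_subset[OF inj_emb])

text \<open>The generators are among the lattice points of \<open>P\<close>, and \<open>P\<close> is
  convex. Counting polygons thereby becomes counting finite subsets of the integer plane.\<close>

lemma polytope_eq_hull_latt:
  assumes "lattice_polytope P"
  shows "P = convex hull (emb ` latt P)"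
proof -
  obtain S where S: "S \<subseteq> int_lattice" "P = convex hull S"
    using assms by (auto simp: lattice_polytope_def)
  then have "S \<subseteq> emb ` latt P"
    using hull_subset[of S convex] by (auto simp: Int_int_lattice[symmetric])
  moreover have "emb ` latt P \<subseteq> P" by (auto simp: latt_def)
  ultimately show ?thesis
    by (metis S(2) convex_convex_hull hull_minimal hull_mono subset_antisym)
qed

text \<open>Positivity of \<open>w\<close> yields finiteness, since \<open>card\<close> of an
  infinite set is 0.\<close>

lemma polytopes_with_countD:
  assumes "P \<in> polytopes_with_count w" "w > 0"
  shows "finite (latt P)" "card (latt P) = w" "P = convex hull (emb ` latt P)" "convex P"
    "latt P \<noteq> {}" "interior P \<noteq> {}"
proof -
  show 1: "card (latt P) = w"
    using assms by (simp add: polytopes_with_count_def lattice_count_eq)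
  then show "finite (latt P)" "latt P \<noteq> {}" using assms(2) card_gt_0_iff by force+
  show P: "P = convex hull (emb ` latt P)"
    using assms polytope_eq_hull_latt by (auto simp: polytopes_with_count_def)
  show "convex P" by (subst P) (rule convex_convex_hull)
  show "interior P \<noteq> {}"
    using assms by (simp add: polytopes_with_count_def full_dimensional_def)
qed

text \<open>Affine maps commute with convex hulls, invertible ones preserve nonempty interior, and
  this one permutes the lattice. \<open>equivalence_rel\<close> asks for membership on both sides;
  only one side has to be checked.\<close>

lemma lattice_equivalent_polytopes_with_count:
  assumes "lattice_equivalent P Q" "P \<in> polytopes_with_count w"
  shows "Q \<in> polytopes_with_count w"
proof -
  obtain A b where A: "invertible A" and L: "(\<lambda>x. A *v x + b) ` int_lattice = int_lattice"
    and Q: "(\<lambda>x. A *v x + b) ` P = Q"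
    using assms(1) by (auto simp: lattice_equivalent_def affine_transformation_def)
  let ?f = "\<lambda>x. A *v x + b"
  have inj: "inj ((*v) A)" by (simp add: A inj_matrix_vector_mult)
  then have injf: "inj ?f" by (auto simp: inj_def)
  have img: "?f ` X = (+) b ` (*v) A ` X" for X
    by (auto simp: image_image add.commute)
  obtain S where S: "finite S" "S \<subseteq> int_lattice" "P = convex hull S"
    and P: "interior P \<noteq> {}" "lattice_count P = w"
    using assms(2) by (auto simp: polytopes_with_count_def lattice_polytope_def full_dimensional_def)
  have "Q = convex hull (?f ` S)"
    unfolding Q[symmetric] S(3) img
    by (simp add: convex_hull_linear_image convex_hull_translation)
  moreover have "?f ` S \<subseteq> int_lattice" using S(2) L by blast
  ultimately have 1: "lattice_polytope Q"
    using S(1) unfolding lattice_polytope_def by blast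
  have "interior Q \<noteq> {}"
    unfolding Q[symmetric] img
    using P(1) inj by (simp add: interior_translation interior_injective_linear_image)
  moreover have "Q \<inter> int_lattice = ?f ` (P \<inter> int_lattice)"
    using L Q injf by (metis image_Int)
  then have "lattice_count Q = w"
    using P(2) injf by (simp add: lattice_count_def card_image inj_on_subset)
  ultimately show ?thesis using 1
    by (simp add: polytopes_with_count_def full_dimensional_def)
qed

definition shear :: "int \<Rightarrow> int \<Rightarrow> int \<Rightarrow> int \<times> int \<Rightarrow> int \<times> int" where
  "shear k u v p = (fst p + u, snd p + k * fst p + v)"

lemma shear_simps [simp]: "fst (shear k u v p) = fst p + u"
  "snd (shear k u v p) = snd p + k * fst p + v"
  by (simp_all add: shear_def)

lemma matrix_mult_2:
  "(vector [vector [a, b], vector [c, d]] :: real^2^2) *v x = vector [a * x $ 1 + b * x $ 2, c * x $ 1 + d * x $ 2]"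
  by (simp add: matrix_vector_mult_def vec_eq_iff forall_2 sum_2)

text \<open>Unimodularity enters as surjectivity of the integer map \<open>g\<close>, which gives
  that the lattice is mapped onto itself; the determinant only supplies invertibility.\<close>

lemma lattice_equivalent_of_bij:
  fixes A :: "real ^ 2 ^ 2"
  assumes "det A \<noteq> 0" and emb: "\<And>p. A *v emb p + b = emb (g p)" and "surj g"
  shows "lattice_equivalent P ((\<lambda>x. A *v x + b) ` P)"
    and "latt ((\<lambda>x. A *v x + b) ` P) = g ` latt P"
proof -
  let ?f = "\<lambda>x. A *v x + b"
  have inv: "invertible A" using assms(1) by (simp add: invertible_det_nz)
  have L: "?f ` int_lattice = int_lattice"
    using \<open>surj g\<close> unfolding int_lattice_eq by (simp add: image_image emb) (metis image_image)
  show "lattice_equivalent P (?f ` P)"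
    unfolding lattice_equivalent_def affine_transformation_def using inv L by blast
  have "inj ?f" using inj_matrix_vector_mult[OF inv] by (auto simp: inj_def)
  then have "?f ` P \<inter> int_lattice = ?f ` (P \<inter> int_lattice)"
    using L by (metis image_Int)
  then have "emb ` latt (?f ` P) = emb ` g ` latt P"
    by (simp add: Int_int_lattice image_image emb)
  then show "latt (?f ` P) = g ` latt P"
    by (simp add: inj_image_eq_iff inj_emb)
qed

lemma shear_equivalent:
  obtains Q where "lattice_equivalent P Q" "latt Q = shear k u v ` latt P"
proof -
  let ?A = "vector [vector [1, 0], vector [of_int k, 1]] :: real^2^2"
  let ?b = "emb (u, v)"
  have "det ?A \<noteq> 0" by (simp add: det_2)
  moreover have "?A *v emb p + ?b = emb (shear k u v p)" for p
    unfolding matrix_mult_2 by (simp add: vec_eq_iff forall_2)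
  moreover have "surj (shear k u v)"
    by (rule surjI[of _ "\<lambda>p. (fst p - u, snd p - k * (fst p - u) - v)"]) (simp add: shear_def)
  ultimately show ?thesis using lattice_equivalent_of_bij[of ?A ?b "shear k u v" P] that by blast
qed

lemma swap_equivalent:
  obtains Q where "lattice_equivalent P Q" "latt Q = prod.swap ` latt P"
proof -
  let ?A = "vector [vector [0, 1], vector [1, 0]] :: real^2^2"
  have "det ?A \<noteq> 0" by (simp add: det_2)
  moreover have "?A *v emb p + 0 = emb (prod.swap p)" for p
    unfolding matrix_mult_2 by (simp add: vec_eq_iff forall_2)
  moreover have "surj (prod.swap :: int \<times> int \<Rightarrow> _)" by simp
  ultimately show ?thesis using lattice_equivalent_of_bij[of ?A 0 prod.swap P] that by blast
qed

section \<open>Convex chains\<close>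

fun steps :: "('a::minus) list \<Rightarrow> 'a list" where
  "steps (p # q # ps) = (q - p) # steps (q # ps)"
| "steps _ = []"

text \<open>Comparing real quotients makes transitivity and asymmetry immediate for all vectors,
  because division by 0 gives 0. Edge vectors of a chain have positive first coordinate, where the
  quotient is the slope.\<close>

definition steeper :: "int \<times> int \<Rightarrow> int \<times> int \<Rightarrow> bool" where
  "steeper d e \<longleftrightarrow> real_of_int (snd d) / of_int (fst d) > of_int (snd e) / of_int (fst e)"

text \<open>The vertical height of \<open>p\<close> above the line of slope \<open>l\<close> through
  the origin.\<close>

definition tilt :: "real \<Rightarrow> int \<times> int \<Rightarrow> real" where
  "tilt l p = of_int (snd p) - l * of_int (fst p)"

text \<open>Every point is the unique highest one in some non-vertical direction: \<open>U\<close>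
  is in strictly convex position and consists of the vertices of its own upper hull.\<close>

definition cap :: "(int \<times> int) set \<Rightarrow> bool" where
  "cap U \<longleftrightarrow> (\<forall>p\<in>U. \<exists>l. \<forall>q\<in>U - {p}. tilt l q < tilt l p)"

lemma cap_subset: "cap U \<Longrightarrow> V \<subseteq> U \<Longrightarrow> cap V"
  unfolding cap_def by blast

text \<open>On a vertical line the difference of two tilts does not depend on the slope, so two
  points there cannot each be strictly highest.\<close>

lemma cap_inj_on_fst:
  assumes "cap U" shows "inj_on fst U"
proof (rule inj_onI)
  fix p q assume *: "p \<in> U" "q \<in> U" "fst p = fst q"
  show "p = q"
  proof (rule ccontr)
    assume "p \<noteq> q"
    then have "q \<in> U - {p}" "p \<in> U - {q}" using * by auto
    then obtain l m where "tilt l q < tilt l p" "tilt m p < tilt m q"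
      using * assms unfolding cap_def by meson
    then have "real_of_int (snd q) < snd p" "real_of_int (snd p) < snd q"
      using * by (simp_all add: tilt_def)
    then show False by simp
  qed
qed

text \<open>By asymmetry the two heads coincide and do not recur, so induction applies to the tails.
  This recovers the list of edge vectors from its set.\<close>

lemma sorted_wrt_eqI:
  assumes "sorted_wrt R xs" "sorted_wrt R ys" "set xs = set ys" "asymp R"
  shows "xs = ys"
  using assms(1-3)
proof (induction xs arbitrary: ys)
  case (Cons x xs)
  then obtain y ys' where ys: "ys = y # ys'" by (cases ys) auto
  have irr: "\<not> R z z" for z using asympD[OF assms(4), of z z] by blast
  have xy: "x = y"
  proof (rule ccontr)
    assume "x \<noteq> y"
    then have "x \<in> set ys'" "y \<in> set xs" using Cons.prems ys by auto
    then have "R y x" "R x y" using Cons.prems ys by auto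
    then show False using asympD[OF assms(4)] by blast
  qed
  have "x \<notin> set xs" "x \<notin> set ys'" using Cons.prems ys irr xy by auto
  then have "set xs = set ys'" using Cons.prems ys xy by auto
  then show ?case using Cons ys xy by auto
qed simp

lemma sorted_wrt_distinct:
  assumes "sorted_wrt R xs" "asymp R"
  shows "distinct xs"
proof -
  have "\<not> R x x" for x using asympD[OF assms(2), of x x] by blast
  with assms(1) show ?thesis by (induction xs) auto
qed

lemma transp_steeper: "transp steeper"
  by (auto simp: transp_def steeper_def)

lemma asymp_steeper: "asymp steeper"
  by (rule asympI) (auto simp: steeper_def)

text \<open>A supporting line at the middle one of three consecutive points has a slope strictly
  between those of the two adjacent edges. Transitivity extends this from neighbours to all
  pairs.\<close>

lemma sorted_steps_cap:
  assumes "sorted_wrt (\<lambda>p q. fst p < fst q) ps" "cap (set ps)"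
  shows "sorted_wrt steeper (steps ps)"
  using assms
proof (induction ps rule: steps.induct)
  case (1 p q ps)
  have IH: "sorted_wrt steeper (steps (q # ps))"
    using 1 by (auto intro: cap_subset)
  show ?case
  proof (cases ps)
    case (Cons r rs)
    have lt: "fst p < fst q" "fst q < fst r" using 1(2) Cons by auto
    have "\<exists>l. \<forall>x\<in>set (p # q # ps) - {q}. tilt l x < tilt l q"
      using 1(3) unfolding cap_def by (rule bspec) simp
    then obtain l where l: "\<forall>x\<in>set (p # q # ps) - {q}. tilt l x < tilt l q" ..
    have "p \<in> set (p # q # ps) - {q}" "r \<in> set (p # q # ps) - {q}" using lt Cons by auto
    with l have "tilt l p < tilt l q" "tilt l r < tilt l q" by blast+
    then have "l * (fst q - fst p) < snd q - snd p" "snd r - snd q < l * (fst r - fst q)"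
      by (simp_all add: tilt_def algebra_simps)
    moreover have "real_of_int (fst q - fst p) > 0" "real_of_int (fst r - fst q) > 0"
      using lt by linarith+
    ultimately have "l < real_of_int (snd q - snd p) / of_int (fst q - fst p)"
        "real_of_int (snd r - snd q) / of_int (fst r - fst q) < l"
      by (simp_all add: field_simps)
    then have "steeper (q - p) (r - q)" by (simp add: steeper_def)
    then show ?thesis using IH Cons
      by (simp add: sorted_wrt2[OF transp_steeper] del: sorted_wrt.simps)
  qed simp
qed auto

lemma steps_inject:
  fixes ps qs :: "('a::group_add) list"
  assumes "hd ps = hd qs" "steps ps = steps qs" "ps \<noteq> []" "qs \<noteq> []"
  shows "ps = qs"
  using assms
proof (induction ps arbitrary: qs rule: steps.induct)
  case (1 p q ps)
  then obtain q' qs' where qs: "qs = p # q' # qs'"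
    by (cases qs rule: steps.cases) auto
  then have "q - p = q' - p" "steps (q # ps) = steps (q' # qs')" using 1 by auto
  then have "q = q'" by (metis diff_add_cancel)
  moreover from this have "q # ps = q' # qs'"
    by (intro "1.IH") (use \<open>steps (q # ps) = steps (q' # qs')\<close> in auto)
  ultimately show ?case using qs by simp
next
  case ("2_2" p)
  then show ?case by (cases qs rule: steps.cases) auto
qed auto

lemma steps_fst_pos:
  fixes ps :: "(int \<times> int) list"
  assumes "sorted_wrt (\<lambda>p q. fst p < fst q) ps" "d \<in> set (steps ps)"
  shows "fst d > 0"
  using assms by (induction ps rule: steps.induct) auto

lemma steps_sum_fst:
  fixes ps :: "(int \<times> int) list"
  assumes "ps \<noteq> []"
  shows "sum_list (map fst (steps ps)) = fst (last ps) - fst (hd ps)"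
  using assms by (induction ps rule: steps.induct) auto

lemma steps_sum_snd:
  fixes ps :: "(int \<times> int) list"
  assumes "ps \<noteq> []"
  shows "sum_list (map snd (steps ps)) = snd (last ps) - snd (hd ps)"
  using assms by (induction ps rule: steps.induct) auto

text \<open>The chain rises first and then falls: once a step does not rise, no later one does.\<close>
lemma steps_sum_abs_snd:
  fixes ps :: "(int \<times> int) list"
  assumes "ps \<noteq> []" "sorted_wrt steeper (steps ps)" "\<forall>d\<in>set (steps ps). fst d > 0"
    "\<forall>p\<in>set ps. 0 \<le> snd p \<and> snd p \<le> b"
  shows "sum_list (map (\<lambda>d. \<bar>snd d\<bar>) (steps ps)) \<le> 2 * b - snd (hd ps)"
  using assms
proof (induction ps rule: steps.induct)
  case (1 p q ps)
  show ?case
  \<comment> \<open>The bound stands for a rise from the first point to height at most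
    \<open>b\<close> and a fall of at most \<open>b\<close>. A rising step contributes exactly what
    the bound loses in passing from \<open>p\<close> to \<open>q\<close>.\<close>
  proof (cases "snd (q - p) > 0")
    case True
    have "sum_list (map (\<lambda>d. \<bar>snd d\<bar>) (steps (q # ps))) \<le> 2 * b - snd (hd (q # ps))"
      by (rule "1.IH") (use 1(2-5) in simp_all)
    then show ?thesis using True by simp
  next
    case False
    have "snd d \<le> 0" if "d \<in> set (steps (q # ps))" for d
    proof -
      have "steeper (q - p) d" "fst d > 0" "fst (q - p) > 0" using 1(3,4) that by simp_all
      then have "real_of_int (snd d) / of_int (fst d) < of_int (snd (q - p)) / of_int (fst (q - p))"
        by (simp add: steeper_def)
      also have "\<dots> \<le> 0" using False \<open>fst (q - p) > 0\<close> by (intro divide_nonpos_pos) simp_all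
      finally show ?thesis using \<open>fst d > 0\<close> by (simp add: divide_less_0_iff)
    qed
    then have "map (\<lambda>d. \<bar>snd d\<bar>) (steps (p # q # ps)) = map (\<lambda>d. - snd d) (steps (p # q # ps))"
      using False by auto
    then have "sum_list (map (\<lambda>d. \<bar>snd d\<bar>) (steps (p # q # ps))) =
        sum_list (map (\<lambda>d. - snd d) (steps (p # q # ps)))"
      by (rule arg_cong)
    also have "\<dots> = - sum_list (map snd (steps (p # q # ps)))"
      by (simp only: uminus_sum_list_map comp_def)
    also have "\<dots> = snd p - snd (last (p # q # ps))"
      by (subst steps_sum_snd) auto
    also have "\<dots> \<le> 2 * b - snd p"
    proof -
      have "0 \<le> snd (last (p # q # ps))" using 1(5) last_in_set[of "p # q # ps"] by blast
      moreover have "0 \<le> snd p" "snd p \<le> b" using 1(5) by auto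
      ultimately show ?thesis by linarith
    qed
    finally show ?thesis by simp
  qed
qed auto

section \<open>Caps in a box and their sets of edge vectors\<close>

definition caps :: "int \<Rightarrow> int \<Rightarrow> (int \<times> int) set set" where
  "caps a b = {U. U \<subseteq> {0..a} \<times> {0..b} \<and> cap U}"

definition step_sets :: "int \<Rightarrow> int \<Rightarrow> (int \<times> int) set set" where
  "step_sets a b = {D. D \<subseteq> {1..a} \<times> {-b..b} \<and> (\<Sum>d\<in>D. fst d) \<le> a \<and> (\<Sum>d\<in>D. \<bar>snd d\<bar>) \<le> 2 * b}"

lemma finite_caps: "finite (caps a b)"
  unfolding caps_def by (rule finite_subset[of _ "Pow ({0..a} \<times> {0..b})"]) auto

lemma finite_step_sets: "finite (step_sets a b)"
  unfolding step_sets_def by (rule finite_subset[of _ "Pow ({1..a} \<times> {-b..b})"]) auto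

lemma cap_enumeration:
  assumes "cap U" "finite U"
  obtains ps where "sorted_wrt (\<lambda>p q. fst p < fst q) ps" "set ps = U"
proof -
  let ?g = "the_inv_into U fst" and ?xs = "sorted_list_of_set (fst ` U)"
  have inj: "inj_on fst U" using assms cap_inj_on_fst by blast
  have "sorted_wrt (<) ?xs" by (rule strict_sorted_list_of_set)
  then have "sorted_wrt (\<lambda>x y. fst (?g x) < fst (?g y)) ?xs"
    by (rule sorted_wrt_mono_rel[rotated]) (use inj assms(2) in \<open>auto simp: f_the_inv_into_f\<close>)
  then have "sorted_wrt (\<lambda>p q. fst p < fst q) (map ?g ?xs)" by (simp add: sorted_wrt_map)
  moreover have "set (map ?g ?xs) = U"
    using inj assms(2) by (simp add: the_inv_into_onto)
  ultimately show ?thesis using that by blast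
qed

lemma steps_in_step_sets:
  assumes ps: "sorted_wrt (\<lambda>p q. fst p < fst q) ps" "set ps \<in> caps a b" "ps \<noteq> []"
  shows "set (steps ps) \<in> step_sets a b"
proof -
  let ?D = "set (steps ps)"
  have box: "set ps \<subseteq> {0..a} \<times> {0..b}" and cap: "cap (set ps)" using ps by (auto simp: caps_def)
  have sorted: "sorted_wrt steeper (steps ps)" by (rule sorted_steps_cap[OF ps(1) cap])
  \<comment> \<open>Strictly decreasing slopes exclude repeated edge vectors, so passing from the
    list to its set keeps the sums.\<close>
  then have dist: "distinct (steps ps)"
    by (rule sorted_wrt_distinct[OF _ asymp_steeper])
  have pos: "\<forall>d\<in>?D. fst d > 0" using steps_fst_pos[OF ps(1)] by blast
  have ends: "hd ps \<in> set ps" "last ps \<in> set ps" using ps(3) by auto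
  then have e: "0 \<le> fst (hd ps)" "fst (last ps) \<le> a" "0 \<le> snd (hd ps)" using box by auto
  have s1: "(\<Sum>d\<in>?D. fst d) \<le> a"
    using steps_sum_fst[OF ps(3)] dist e by (simp add: sum_list_distinct_conv_sum_set)
  have "\<forall>p\<in>set ps. 0 \<le> snd p \<and> snd p \<le> b" using box by auto
  from steps_sum_abs_snd[OF ps(3) sorted pos this]
  have s2: "(\<Sum>d\<in>?D. \<bar>snd d\<bar>) \<le> 2 * b"
    using dist e by (simp add: sum_list_distinct_conv_sum_set)
  have "fst d \<le> a" if "d \<in> ?D" for d
    using member_le_sum[of d ?D fst] pos that s1 by force
  moreover have "snd d \<in> {-b..b}" if "d \<in> ?D" for d
    using that box
  proof (induction ps rule: steps.induct)
    case (1 p q ps)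
    show ?case
    proof (cases "d = q - p")
      case True
      then show ?thesis using 1 by auto
    next
      case False
      then show ?thesis using 1 by simp
    qed
  qed auto
  ultimately show ?thesis using s1 s2 pos by (force simp: step_sets_def)
qed

text \<open>A nonempty cap is encoded by its leftmost point and its set of edge vectors. Sorting
  that set by slope restores the edge list, and partial sums restore the points. The summand 1 is
  the empty cap.\<close>

lemma card_caps:
  assumes "a \<ge> 0" "b \<ge> 0"
  shows "card (caps a b) \<le> 1 + nat (a + 1) * nat (b + 1) * card (step_sets a b)"
proof -
  let ?B = "{0..a} \<times> {0..b}"
  define enum where "enum U = (SOME ps. sorted_wrt (\<lambda>p q. fst p < fst q) ps \<and> set ps = U)"
    for U :: "(int \<times> int) set"
  have enum: "sorted_wrt (\<lambda>p q. fst p < fst q) (enum U)" "set (enum U) = U" if "U \<in> caps a b" for U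
  proof -
    have "cap U" "finite U" using that by (auto simp: caps_def intro: finite_subset)
    then have "\<exists>ps. sorted_wrt (\<lambda>p q. fst p < fst q) ps \<and> set ps = U"
      using cap_enumeration by metis
    from someI_ex[OF this]
    show "sorted_wrt (\<lambda>p q. fst p < fst q) (enum U)" "set (enum U) = U" by (simp_all add: enum_def)
  qed
  define code where "code U = (hd (enum U), set (steps (enum U)))" for U
  let ?C = "caps a b - {{}}"
  have ne: "enum U \<noteq> []" if "U \<in> ?C" for U using enum(2)[of U] that by auto
  have "inj_on code ?C"
  proof (rule inj_onI)
    fix U V assume U: "U \<in> ?C" and V: "V \<in> ?C" and eq: "code U = code V"
    have "steps (enum U) = steps (enum V)"
      by (rule sorted_wrt_eqI[OF _ _ _ asymp_steeper])
         (use U V eq enum in \<open>auto simp: code_def caps_def intro!: sorted_steps_cap\<close>)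
    moreover have "hd (enum U) = hd (enum V)" using eq by (simp add: code_def)
    ultimately have "enum U = enum V" using steps_inject ne[OF U] ne[OF V] by blast
    moreover have "U \<in> caps a b" "V \<in> caps a b" using U V by simp_all
    then have "set (enum U) = U" "set (enum V) = V" by (simp_all only: enum(2))
    ultimately show "U = V" by metis
  qed
  moreover have "code ` ?C \<subseteq> ?B \<times> step_sets a b"
  proof (rule image_subsetI)
    fix U assume U: "U \<in> ?C"
    then have UC: "U \<in> caps a b" by simp
    have "hd (enum U) \<in> set (enum U)" using ne[OF U] by simp
    then have "hd (enum U) \<in> ?B" using UC unfolding enum(2)[OF UC] by (auto simp: caps_def)
    moreover have "set (steps (enum U)) \<in> step_sets a b"
      by (rule steps_in_step_sets) (use enum[OF UC] UC ne[OF U] in simp_all)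
    ultimately show "code U \<in> ?B \<times> step_sets a b" by (simp add: code_def)
  qed
  ultimately have "card ?C \<le> card (?B \<times> step_sets a b)"
    by (intro card_inj_on_le) (auto simp: finite_step_sets)
  also have "\<dots> = nat (a + 1) * nat (b + 1) * card (step_sets a b)"
    by (simp add: card_cartesian_product)
  finally show ?thesis
    using card_Diff1_le[of "caps a b" "{}"] card_Suc_Diff1[OF finite_caps[of a b], of "{}"]
    by (cases "{} \<in> caps a b") auto
qed

section \<open>Exponential weights on sets of edge vectors\<close>

text \<open>Since \<open>1 + s \<le> exp s\<close>, each term is at most \<open>1 / s\<close> times
  the drop of \<open>exp (- s * x)\<close> over the preceding unit interval, and the drops
  telescope.\<close>

lemma sum_exp_le:
  fixes s :: real
  assumes "s > 0"
  shows "(\<Sum>x\<in>{1..n::int}. exp (- s * x)) \<le> 1 / s"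
proof -
  have step: "exp (- s * (x + 1)) \<le> (exp (- s * x) - exp (- s * (x + 1))) / s" for x :: real
  proof -
    have "exp (- s * (x + 1)) * (1 + s) \<le> exp (- s * (x + 1)) * exp s"
      by (intro mult_left_mono) auto
    also have "\<dots> = exp (- s * x)" by (simp add: exp_add[symmetric] algebra_simps)
    finally show ?thesis using assms by (simp add: field_simps)
  qed
  have "(\<Sum>x\<in>{1..int m}. exp (- s * x)) \<le> (1 - exp (- s * m)) / s" for m
  proof (induction m)
    case (Suc m)
    have "{1..int (Suc m)} = insert (int m + 1) {1..int m}" by auto
    then have "(\<Sum>x\<in>{1..int (Suc m)}. exp (- s * x)) =
        exp (- s * (real m + 1)) + (\<Sum>x\<in>{1..int m}. exp (- s * x))"
      by simp
    also have "\<dots> \<le> (exp (- s * m) - exp (- s * (real m + 1))) / s + (1 - exp (- s * m)) / s"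
      using step[of m] Suc by (intro add_mono) auto
    also have "\<dots> = (1 - exp (- s * Suc m)) / s" by (simp add: diff_divide_distrib add.commute)
    finally show ?case .
  qed simp
  from this[of "nat n"] have "(\<Sum>x\<in>{1..int (nat n)}. exp (- s * x)) \<le> 1 / s"
    using assms by (smt (verit) divide_right_mono exp_gt_zero)
  then show ?thesis by (cases "n \<ge> 0") (use assms in auto)
qed

text \<open>Every admissible set has product weight at least
  \<open>exp (- (s * a + 2 * t * b))\<close>. The weights of all subsets of the box sum to the
  product of the factors \<open>f d + 1\<close>, which is at most the exponential of the sum of
  \<open>f\<close>; that sum splits into two geometric ones.\<close>

lemma card_step_sets:
  fixes s t :: real
  assumes "s > 0" "t > 0" "b \<ge> 0"
  shows "card (step_sets a b) \<le> exp (s * a + 2 * t * b + (1 / s) * (1 + 2 / t))"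
proof -
  let ?V = "{1..a} \<times> {-b..b}"
  define f where "f d = exp (- s * fst d - t * \<bar>snd d\<bar>)" for d :: "int \<times> int"
  have f_pos: "f d > 0" for d by (simp add: f_def)
  have "card (step_sets a b) = (\<Sum>D\<in>step_sets a b. 1 :: real)" by simp
  also have "\<dots> \<le> (\<Sum>D\<in>step_sets a b. exp (s * a + 2 * t * b) * (\<Prod>d\<in>D. f d))"
  proof (rule sum_mono)
    fix D assume D: "D \<in> step_sets a b"
    then have fin: "finite D" by (auto simp: step_sets_def intro: finite_subset)
    define X Y where "X = (\<Sum>d\<in>D. real_of_int (fst d))" and "Y = (\<Sum>d\<in>D. real_of_int \<bar>snd d\<bar>)"
    have "(\<Sum>d\<in>D. fst d) \<le> a" "(\<Sum>d\<in>D. \<bar>snd d\<bar>) \<le> 2 * b"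
      using D by (simp_all add: step_sets_def)
    then have "real_of_int (\<Sum>d\<in>D. fst d) \<le> of_int a" "real_of_int (\<Sum>d\<in>D. \<bar>snd d\<bar>) \<le> of_int (2 * b)"
      by (simp_all only: of_int_le_iff)
    then have "X \<le> a" "Y \<le> 2 * b" by (simp_all add: X_def Y_def)
    then have "s * X \<le> s * a" "t * Y \<le> t * (2 * b)"
      using assms by (simp_all add: mult_left_mono)
    then have "1 \<le> exp ((s * a + 2 * t * b) + (- s * X - t * Y))"
      by simp
    also have "- s * X - t * Y = (\<Sum>d\<in>D. - s * fst d - t * \<bar>snd d\<bar>)"
      by (simp add: X_def Y_def sum_subtractf sum_distrib_left sum_negf)
    also have "exp ((s * a + 2 * t * b) + \<dots>) = exp (s * a + 2 * t * b) * (\<Prod>d\<in>D. f d)"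
      by (simp add: exp_add exp_sum[OF fin] f_def)
    finally show "1 \<le> exp (s * a + 2 * t * b) * (\<Prod>d\<in>D. f d)" .
  qed
  also have "\<dots> \<le> (\<Sum>D\<in>Pow ?V. exp (s * a + 2 * t * b) * (\<Prod>d\<in>D. f d))"
    by (rule sum_mono2) (auto simp: step_sets_def intro!: mult_nonneg_nonneg prod_nonneg less_imp_le[OF f_pos])
  also have "\<dots> = exp (s * a + 2 * t * b) * (\<Prod>d\<in>?V. f d + 1)"
    by (subst prod_add) (auto simp: sum_distrib_left)
  also have "\<dots> \<le> exp (s * a + 2 * t * b) * (\<Prod>d\<in>?V. exp (f d))"
    by (intro mult_left_mono prod_mono) (auto simp: add.commute intro: add_nonneg_nonneg less_imp_le[OF f_pos])
  also have "\<dots> = exp (s * a + 2 * t * b + (\<Sum>d\<in>?V. f d))"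
    by (simp add: exp_sum exp_add)
  also have "(\<Sum>d\<in>?V. f d) = (\<Sum>x\<in>{1..a}. exp (- s * x)) * (\<Sum>y\<in>{-b..b}. exp (- t * \<bar>y\<bar>))"
    by (simp add: f_def sum_product sum.cartesian_product case_prod_beta exp_diff exp_minus divide_inverse)
  also have "(\<Sum>y\<in>{-b..b}. exp (- t * \<bar>y\<bar>)) = 1 + 2 * (\<Sum>y\<in>{1..b}. exp (- t * y))"
  proof -
    have split: "{-b..b} = insert 0 ({1..b} \<union> uminus ` {1..b})" using assms(3) by auto
    have "(\<Sum>y\<in>{-b..b}. exp (- t * \<bar>y\<bar>)) =
        1 + ((\<Sum>y\<in>{1..b}. exp (- t * \<bar>y\<bar>)) + (\<Sum>y\<in>uminus ` {1..b}. exp (- t * \<bar>y\<bar>)))"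
      unfolding split by (subst sum.insert, simp, force, subst sum.union_disjoint) auto
    also have "(\<Sum>y\<in>uminus ` {1..b}. exp (- t * \<bar>y\<bar>)) = (\<Sum>y\<in>{1..b}. exp (- t * \<bar>y\<bar>))"
      by (subst sum.reindex) auto
    finally show ?thesis by simp
  qed
  finally have *: "card (step_sets a b) \<le> exp (s * a + 2 * t * b +
      (\<Sum>x\<in>{1..a}. exp (- s * x)) * (1 + 2 * (\<Sum>y\<in>{1..b}. exp (- t * y))))" .
  have "(\<Sum>x\<in>{1..a}. exp (- s * x)) * (1 + 2 * (\<Sum>y\<in>{1..b}. exp (- t * y))) \<le> (1 / s) * (1 + 2 / t)"
    using sum_exp_le[OF assms(1), of a] sum_exp_le[OF assms(2), of b] assms
    by (intro mult_mono) (auto intro!: add_nonneg_nonneg sum_nonneg)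
  then have "exp (s * a + 2 * t * b +
      (\<Sum>x\<in>{1..a}. exp (- s * x)) * (1 + 2 * (\<Sum>y\<in>{1..b}. exp (- t * y))))
    \<le> exp (s * a + 2 * t * b + (1 / s) * (1 + 2 / t))"
    by (intro iffD2[OF exp_le_cancel_iff] add_left_mono)
  with * show ?thesis by (rule order_trans)
qed

section \<open>Boxes containing a representative\<close>

lemma emb_eq_vector: "emb (x, y) = vector [of_int x, of_int y]"
  by (simp add: emb_def)

lemma vector_2_combine:
  "u *\<^sub>R (vector [a, b] :: real^2) + v *\<^sub>R vector [c, d] = vector [u * a + v * c, u * b + v * d]"
  by (simp add: vec_eq_iff forall_2)

lemma convex_vertical:
  fixes P :: "(real ^ 2) set"
  assumes "convex P" "vector [x, lo] \<in> P" "vector [x, hi] \<in> P" "lo \<le> y" "y \<le> hi"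
  shows "vector [x, y] \<in> P"
proof (cases "lo = hi")
  case False
  define u where "u = (y - lo) / (hi - lo)"
  have u: "0 \<le> u" "u \<le> 1" "(1 - u) * lo + u * hi = y"
    using assms(4,5) False by (auto simp: u_def divide_simps) (simp add: algebra_simps)
  have "(1 - u) *\<^sub>R vector [x, lo] + u *\<^sub>R vector [x, hi] \<in> P"
    using u assms by (intro convexD_alt)
  moreover have "(1 - u) * x + u * x = x" by (simp add: algebra_simps)
  ultimately show ?thesis using u(3) by (simp add: vector_2_combine)
qed (use assms in auto)

lemma card_int_interval_ge: "\<beta> - \<alpha> - 1 \<le> real (card {\<lceil>\<alpha>\<rceil>..\<lfloor>\<beta>\<rfloor>})" for \<alpha> \<beta> :: real
proof -
  have "\<beta> - \<alpha> - 1 \<le> real_of_int (\<lfloor>\<beta>\<rfloor> - \<lceil>\<alpha>\<rceil> + 1)"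
    by linarith
  also have "\<dots> \<le> real (nat (\<lfloor>\<beta>\<rfloor> - \<lceil>\<alpha>\<rceil> + 1))" by linarith
  finally show ?thesis by simp
qed

text \<open>The vertical line at distance \<open>j\<close> from the apex meets the triangle in a
  segment of length \<open>(hi - lo) * j / m\<close>, which contains at least that many lattice
  points minus one. Summing over the columns gives the bound; \<open>sg\<close> selects the side on
  which the base lies.\<close>

lemma card_latt_triangle_ge:
  fixes P :: "(real ^ 2) set" and sg :: int and m :: nat
  assumes P: "convex P" "finite (latt P)" and sg: "sg = 1 \<or> sg = -1" and "m > 0"
    and apex: "emb (x, y) \<in> P"
    and base: "vector [of_int (x + sg * int m), lo] \<in> P" "vector [of_int (x + sg * int m), hi] \<in> P"
    and "lo \<le> hi"
  shows "(real m + 1) * ((hi - lo) / 2 - 1) \<le> card (latt P)"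
proof -
  define lo' hi' where "lo' j = y + (lo - y) * real j / m" and "hi' j = y + (hi - y) * real j / m" for j
  define col where "col j = {\<lceil>lo' j\<rceil>..\<lfloor>hi' j\<rfloor>}" for j
  have chord: "vector [of_int (x + sg * int j), y + (z - y) * real j / m] \<in> P"
    if "j \<le> m" "vector [of_int (x + sg * int m), z] \<in> P" for j and z :: real
  proof -
    define u where "u = real j / m"
    have "(1 - u) *\<^sub>R emb (x, y) + u *\<^sub>R vector [of_int (x + sg * int m), z] \<in> P"
      using that apex P(1) \<open>m > 0\<close> by (intro convexD_alt) (auto simp: u_def)
    moreover have "(1 - u) * x + u * of_int (x + sg * int m) = of_int (x + sg * int j)"
      using \<open>m > 0\<close> by (simp add: u_def field_simps)
    moreover have "(1 - u) * y + u * z = y + (z - y) * real j / m"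
      using \<open>m > 0\<close> by (simp add: u_def field_simps)
    ultimately show ?thesis by (simp only: emb_eq_vector vector_2_combine)
  qed
  have "(x + sg * int j, v) \<in> latt P" if "j \<le> m" "v \<in> col j" for j v
  proof -
    have "lo' j \<le> v" "v \<le> hi' j" using that(2) by (auto simp: col_def ceiling_le_iff le_floor_iff)
    then have "vector [of_int (x + sg * int j), of_int v] \<in> P"
      using convex_vertical[OF P(1) chord[OF that(1) base(1)] chord[OF that(1) base(2)]]
      by (simp add: lo'_def hi'_def)
    then show ?thesis by (simp add: latt_def emb_eq_vector)
  qed
  then have "(\<lambda>(j, v). (x + sg * int j, v)) ` (SIGMA j:{0..m}. col j) \<subseteq> latt P" by auto
  moreover have "inj_on (\<lambda>(j, v). (x + sg * int j, v)) (SIGMA j:{0..m}. col j)"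
    using sg by (auto simp: inj_on_def)
  ultimately have "card (SIGMA j:{0..m}. col j) \<le> card (latt P)"
    using P(2) by (metis card_image card_mono)
  then have card: "(\<Sum>j=0..m. real (card (col j))) \<le> card (latt P)"
    by (simp add: col_def flip: of_nat_sum)
  have "(\<Sum>j=0..m. (hi - lo) / m * real j - 1) \<le> (\<Sum>j=0..m. real (card (col j)))"
  proof (rule sum_mono)
    fix j
    have "(hi - lo) / m * real j - 1 = hi' j - lo' j - 1"
      using \<open>m > 0\<close> by (simp add: hi'_def lo'_def field_simps)
    then show "(hi - lo) / m * real j - 1 \<le> real (card (col j))"
      using card_int_interval_ge[of "hi' j" "lo' j"] by (simp add: col_def)
  qed
  also have "(\<Sum>j=0..m. (hi - lo) / m * real j - 1) = (hi - lo) / m * (\<Sum>j=0..m. real j) - (m + 1)"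
    by (simp add: sum_subtractf sum_distrib_left)
  also have "(\<Sum>j=0..m. real j) = real m * (m + 1) / 2"
    by (induction m) (simp_all add: field_simps)
  also have "(hi - lo) / m * (real m * (m + 1) / 2) - (m + 1) = (real m + 1) * ((hi - lo) / 2 - 1)"
    using \<open>m > 0\<close> by (simp add: field_simps)
  finally show ?thesis using card by linarith
qed

lemma vertical_line_interior_empty:
  assumes "latt P \<subseteq> {0} \<times> UNIV" "P = convex hull (emb ` latt P)"
  shows "interior P = {}"
proof -
  have "convex {x :: real ^ 2. x $ 1 = 0}"
    using convex_hyperplane[of "axis 1 1 :: real ^ 2" 0] by (simp add: inner_axis' )
  moreover have "emb ` latt P \<subseteq> {x. x $ 1 = 0}" using assms(1) by auto
  ultimately have "P \<subseteq> {x. x $ 1 = 0}" using assms(2) by (metis hull_minimal)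
  then have "interior P \<subseteq> interior {x. x $ 1 = 0}" by (rule interior_mono)
  then show ?thesis by (simp add: interior_standard_hyperplane)
qed

text \<open>Among all polygons equivalent to \<open>P\<close>, one of least horizontal extent \<open>a\<close> is sheared so that
  a leftmost and a rightmost point are joined by a segment of slope at most \<open>1/2\<close>. If \<open>h\<close> is the
  largest vertical distance from this segment, the vertical extent is at most \<open>a / 2 + 2 * h\<close>;
  minimality (compare with the polygon reflected in the diagonal) turns this into \<open>a, b \<le> 4 * h\<close>,
  while the polygon contains a triangle of area at least \<open>a * h / 4\<close>.\<close>
lemma small_box_representative:
  assumes P: "P \<in> polytopes_with_count w" and w: "w \<ge> 8"
  obtains Q a b where "lattice_equivalent P Q" "1 \<le> a" "a \<le> b" "a * b \<le> 32 * int w"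
    "latt Q \<subseteq> {0..a} \<times> {0..b}"
proof -
  define ext where "ext S = Max (fst ` S) - Min (fst ` S)" for S :: "(int \<times> int) set"
  have pos: "w > 0" using w by simp
  have fin: "finite (latt Q)" "latt Q \<noteq> {}" if "lattice_equivalent P Q" for Q
    using polytopes_with_countD[OF lattice_equivalent_polytopes_with_count[OF that P] pos] by auto
  obtain Q0 where Q0: "lattice_equivalent P Q0"
    and "\<forall>Q. lattice_equivalent P Q \<longrightarrow> nat (ext (latt Q0)) \<le> nat (ext (latt Q))"
    using ex_has_least_nat[of "lattice_equivalent P" P "\<lambda>Q. nat (ext (latt Q))", OF lattice_equivalent_refl]
    by blast
  \<comment> \<open>The minimum was taken over natural numbers; extents are nonnegative, so
    \<open>nat\<close> loses nothing.\<close>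
  moreover have "ext (latt Q) \<ge> 0" if "lattice_equivalent P Q" for Q
    using fin[OF that] by (simp add: ext_def)
  ultimately have least: "ext (latt Q0) \<le> ext (latt Q)" if "lattice_equivalent P Q" for Q
    using that Q0 by (meson nat_le_eq_zle order_trans zle_iff_zadd nat_le_iff eq_nat_nat_iff nat_mono_iff linorder_not_le)
  define S0 where "S0 = latt Q0"
  have S0: "finite S0" "S0 \<noteq> {}" using fin[OF Q0] by (auto simp: S0_def)
  have "Min (fst ` S0) \<in> fst ` S0" "Max (fst ` S0) \<in> fst ` S0" using S0 by simp_all
  then obtain p q where p: "p \<in> S0" "fst p = Min (fst ` S0)" and q: "q \<in> S0" "fst q = Max (fst ` S0)"
    by (metis imageE)
  define a where "a = fst q - fst p"
  have a_ext: "ext (latt Q0) = a" by (simp add: a_def ext_def p q S0_def)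
  have "a \<ge> 0" using S0 p(1) by (simp add: a_def q)
  \<comment> \<open>This shear turns the slope of the segment from \<open>p\<close> to
    \<open>q\<close> into a rounding error, of absolute value at most 1/2. At this point
    \<open>a = 0\<close> is still possible; the quotient is then 0.\<close>
  define k where "k = - round ((snd q - snd p) / a)"
  \<comment> \<open>Together with the shift by \<open>- fst p\<close> this moves the lower left
    corner of the bounding box to the origin.\<close>
  define v where "v = - Min ((\<lambda>s. snd s + k * fst s) ` S0)"
  obtain Q where "lattice_equivalent Q0 Q" and lattQ: "latt Q = shear k (- fst p) v ` S0"
    unfolding S0_def by (rule shear_equivalent)
  then have Q: "lattice_equivalent P Q" using Q0 lattice_equivalent_trans by blast
  note Qp = polytopes_with_countD[OF lattice_equivalent_polytopes_with_count[OF Q P] pos]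
  define S where "S = latt Q"
  have S: "finite S" "S \<noteq> {}" "card S = w" using Qp by (auto simp: S_def)
  define b where "b = Max (snd ` S)"
  have fstS: "0 \<le> fst s" "fst s \<le> a" if "s \<in> S" for s
  proof -
    obtain s0 where s0: "s0 \<in> S0" "s = shear k (- fst p) v s0"
      using \<open>s \<in> S\<close> by (auto simp: S_def lattQ)
    have "fst p \<le> fst s0" "fst s0 \<le> fst q" using S0 s0(1) by (simp_all add: p(2) q(2))
    then show "0 \<le> fst s" "fst s \<le> a" using s0(2) by (simp_all add: a_def)
  qed
  have "Min ((\<lambda>s. snd s + k * fst s) ` S0) \<in> (\<lambda>s. snd s + k * fst s) ` S0" using S0 by simp
  then obtain t0 where "t0 \<in> S0" "snd t0 + k * fst t0 = - v" unfolding v_def by fastforce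
  then obtain t where t: "t \<in> S" "snd t = 0" unfolding S_def lattQ by (force simp: shear_def)
  have "snd s \<ge> 0" if "s \<in> S" for s
  proof -
    obtain s0 where s0: "s0 \<in> S0" "s = shear k (- fst p) v s0" using \<open>s \<in> S\<close> by (auto simp: S_def lattQ)
    then have "Min ((\<lambda>s. snd s + k * fst s) ` S0) \<le> snd s0 + k * fst s0"
      using S0 by (intro Min_le) auto
    then show ?thesis using s0(2) by (simp only: v_def shear_simps)
  qed
  moreover have "snd s \<le> b" if "s \<in> S" for s using that S by (simp add: b_def)
  ultimately have box: "S \<subseteq> {0..a} \<times> {0..b}" using fstS by (auto simp: mem_Times_iff)
  have "b \<in> snd ` S" using S by (simp add: b_def)
  then obtain t' where t': "t' \<in> S" "snd t' = b" by blast
  \<comment> \<open>Swapping the coordinates makes \<open>b\<close> the horizontal extent of an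
    equivalent polygon, so minimality applies.\<close>
  have "a \<le> b"
  proof -
    obtain R where "lattice_equivalent Q R" and R: "latt R = prod.swap ` S"
      unfolding S_def by (rule swap_equivalent)
    then have "a \<le> ext (latt R)"
      using least[of R] Q lattice_equivalent_trans a_ext by metis
    also have "fst ` latt R = snd ` S" by (auto simp: R image_image)
    then have "ext (latt R) = b - Min (snd ` S)" by (simp add: ext_def b_def)
    also have "Min (snd ` S) = 0" using S box t by (intro Min_eqI) force+
    finally show ?thesis by simp
  qed
  have "a \<ge> 1"
  proof (rule ccontr)
    assume "\<not> a \<ge> 1"
    then have "latt Q \<subseteq> {0} \<times> UNIV" using box S_def by auto
    then show False using vertical_line_interior_empty[OF _ Qp(3)] Qp(6) by blast
  qed
  define p' q' where "p' = shear k (- fst p) v p" and "q' = shear k (- fst p) v q"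
  have p': "p' \<in> S" "fst p' = 0" and q': "q' \<in> S" "fst q' = a"
    using p q by (auto simp: p'_def q'_def S_def lattQ a_def)
  define c where "c = (snd q' - snd p') / a"
  have "c = (snd q - snd p) / a - round ((snd q - snd p) / a)"
    using \<open>a \<ge> 1\<close> by (simp add: c_def p'_def q'_def k_def a_def field_simps)
  then have c: "\<bar>c\<bar> \<le> 1 / 2"
    using of_int_round_abs_le[of "(snd q - snd p) / a"] by linarith
  \<comment> \<open>The signed vertical distance of \<open>s\<close> from the line through
    \<open>p'\<close> and \<open>q'\<close>.\<close>
  define dev where "dev s = snd s - snd p' - c * fst s" for s :: "int \<times> int"
  have "Max ((\<lambda>s. \<bar>dev s\<bar>) ` S) \<in> (\<lambda>s. \<bar>dev s\<bar>) ` S" using S by simp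
  then obtain r where r: "r \<in> S" "\<bar>dev r\<bar> = Max ((\<lambda>s. \<bar>dev s\<bar>) ` S)" by force
  define h where "h = \<bar>dev r\<bar>"
  have dev: "\<bar>dev s\<bar> \<le> h" if "s \<in> S" for s using that S by (simp add: h_def r)
  have "b \<le> a / 2 + 2 * h"
  proof -
    have "b = (dev t' - dev t) + c * (fst t' - fst t)"
      using t t' by (simp add: dev_def algebra_simps)
    also have "dev t' - dev t \<le> 2 * h" using dev[OF t(1)] dev[OF t'(1)] by linarith
    also have "c * (fst t' - fst t) \<le> \<bar>c\<bar> * \<bar>of_int (fst t' - fst t)\<bar>"
      by (metis abs_ge_self abs_mult of_int_diff)
    also have "\<bar>c\<bar> * \<bar>of_int (fst t' - fst t)\<bar> \<le> 1 / 2 * real_of_int a"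
      using c fstS[OF t(1)] fstS[OF t'(1)] by (intro mult_mono) auto
    finally show ?thesis by simp
  qed
  \<comment> \<open>From \<open>a \<le> b \<le> a / 2 + 2 * h\<close> one gets
    \<open>a / 2 \<le> 2 * h\<close>, and then the bound for \<open>b\<close>.\<close>
  then have ah: "a \<le> 4 * h" and bh: "b \<le> 4 * h" using \<open>a \<le> b\<close> by linarith+
  \<comment> \<open>The triangle has as base the vertical segment from \<open>r\<close> to the chord
    between \<open>p'\<close> and \<open>q'\<close>, and as apex whichever of these two is
    horizontally farther away, so that \<open>m\<close> is at least \<open>a / 2\<close>.\<close>
  have area: "a / 2 * (h / 2 - 1) \<le> w" if "h \<ge> 4"
  proof -
    define x where "x = fst r"
    define lo hi where "lo = min (snd r) (snd r - dev r)" and "hi = max (snd r) (snd r - dev r)"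
    have x: "0 \<le> x" "x \<le> a" using fstS[OF r(1)] by (auto simp: x_def)
    have SQ: "vector [of_int (fst s), of_int (snd s)] \<in> Q" if "s \<in> S" for s
      using that by (auto simp: S_def latt_def emb_def)
    define u where "u = real_of_int x / a"
    have "(1 - u) *\<^sub>R vector [of_int (fst p'), of_int (snd p')] + u *\<^sub>R vector [of_int (fst q'), of_int (snd q')] \<in> Q"
      using x Qp(4) SQ[OF p'(1)] SQ[OF q'(1)] \<open>a \<ge> 1\<close> by (intro convexD_alt) (auto simp: u_def)
    moreover have "(1 - u) * fst p' + u * fst q' = x" using \<open>a \<ge> 1\<close> by (simp add: u_def p' q')
    moreover have "(1 - u) * snd p' + u * snd q' = snd r - dev r"
      using \<open>a \<ge> 1\<close> by (simp add: u_def dev_def c_def x_def field_simps)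
    ultimately have "vector [of_int x, snd r - dev r] \<in> Q" by (simp only: vector_2_combine)
    then have base: "vector [of_int x, lo] \<in> Q" "vector [of_int x, hi] \<in> Q"
      using SQ[OF r(1)] by (auto simp: lo_def hi_def min_def max_def x_def)
    have h: "hi - lo = h" "lo \<le> hi" by (auto simp: hi_def lo_def h_def)
    have apex: "emb (fst p', snd p') \<in> Q" "emb (fst q', snd q') \<in> Q"
      using p'(1) q'(1) by (auto simp: S_def latt_def)
    obtain m :: nat where m: "a / 2 \<le> m" "(real m + 1) * (h / 2 - 1) \<le> w"
    proof (cases "a \<le> 2 * x")
      case True
      then have "nat x > 0" "fst p' + 1 * int (nat x) = x" using \<open>a \<ge> 1\<close> p' by auto
      then have "(real (nat x) + 1) * (h / 2 - 1) \<le> w"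
        using card_latt_triangle_ge[OF Qp(4,1), of 1 "nat x" "fst p'" "snd p'" lo hi] apex base h Qp(2) by simp
      then show ?thesis using True x by (intro that[of "nat x"]) auto
    next
      case False
      then have "nat (a - x) > 0" "fst q' + (-1) * int (nat (a - x)) = x" using \<open>a \<ge> 1\<close> q' x by auto
      then have "(real (nat (a - x)) + 1) * (h / 2 - 1) \<le> w"
        using card_latt_triangle_ge[OF Qp(4,1), of "-1" "nat (a - x)" "fst q'" "snd q'" lo hi] apex base h Qp(2) by simp
      then show ?thesis using False x by (intro that[of "nat (a - x)"]) auto
    qed
    have "a / 2 * (h / 2 - 1) \<le> (real m + 1) * (h / 2 - 1)"
      using m(1) \<open>h \<ge> 4\<close> by (intro mult_right_mono) auto
    then show ?thesis using m(2) by linarith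
  qed
  have "real_of_int a * b \<le> 32 * w"
  proof (cases "h \<ge> 4")
    case True
    have "real_of_int a * b \<le> a * (4 * h)" using bh \<open>a \<ge> 1\<close> by (intro mult_left_mono) auto
    also have "\<dots> = 32 * (a / 2 * (h / 4))" by simp
    also have "a / 2 * (h / 4) \<le> a / 2 * (h / 2 - 1)" using True \<open>a \<ge> 1\<close> by (intro mult_left_mono) auto
    also have "\<dots> \<le> w" by (rule area[OF True])
    finally show ?thesis by simp
  next
    \<comment> \<open>Here \<open>a\<close> and \<open>b\<close> are at most 16, and 16 * 16 = 32 *
      8; this is the source of \<open>w \<ge> 8\<close>.\<close>
    case False
    then have "real_of_int a * b \<le> 16 * 16" using ah bh \<open>a \<ge> 1\<close> \<open>a \<le> b\<close> by (intro mult_mono) auto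
    then show ?thesis using w by simp
  qed
  then have "real_of_int (a * b) \<le> of_int (32 * int w)" by simp
  then have "a * b \<le> 32 * int w" by (simp only: of_int_le_iff)
  then show ?thesis using that[OF Q \<open>a \<ge> 1\<close> \<open>a \<le> b\<close>] box S_def by blast
qed

section \<open>Counting the classes from above\<close>

text \<open>Reflecting the box upside down turns lower chains into caps, so one count serves
  both.\<close>

definition flip :: "int \<Rightarrow> int \<times> int \<Rightarrow> int \<times> int" where
  "flip b p = (fst p, b - snd p)"

lemma inner_emb: "v \<bullet> emb p = v $ 1 * of_int (fst p) + v $ 2 * of_int (snd p)"
  by (simp add: inner_vec_def sum_2)

text \<open>A line strictly separates the vertex from the hull of the other points. If it is not
  vertical, the sign of the second coordinate of its normal decides between above and below; a
  vertical line can be tilted.\<close>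

lemma exposed_above_or_below:
  assumes T: "T \<subseteq> {0..a} \<times> {0..b}" and p: "p \<in> T" "emb p \<notin> convex hull (emb ` (T - {p}))"
  shows "(\<exists>l. \<forall>q\<in>T - {p}. tilt l q < tilt l p) \<or>
    (\<exists>l. \<forall>q\<in>T - {p}. tilt l p < tilt l q)"
proof -
  have "finite T" using T by (auto intro: finite_subset)
  then have "closed (convex hull (emb ` (T - {p})))"
    by (intro compact_imp_closed finite_imp_compact_convex_hull) auto
  then obtain v \<beta> where "v \<bullet> emb p < \<beta>" "\<forall>x\<in>convex hull (emb ` (T - {p})). \<beta> < v \<bullet> x"
    using separating_hyperplane_closed_point[OF convex_convex_hull _ p(2)] by blast
  moreover have "emb q \<in> convex hull (emb ` (T - {p}))" if "q \<in> T - {p}" for q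
    using that by (intro hull_inc) auto
  ultimately have "v \<bullet> emb p < v \<bullet> emb q" if "q \<in> T - {p}" for q
    using that by (meson less_trans)
  then have v: "v $ 1 * of_int (fst p) + v $ 2 * of_int (snd p) < v $ 1 * of_int (fst q) + v $ 2 * of_int (snd q)" if "q \<in> T - {p}" for q
    using that by (simp only: inner_emb)
  define m where "m = - v $ 1 / v $ 2"
  have tilt: "tilt m q = (v $ 1 * of_int (fst q) + v $ 2 * of_int (snd q)) / v $ 2"
    if "v $ 2 \<noteq> 0" for q
    using that by (simp add: tilt_def m_def field_simps)
  consider "v $ 2 > 0" | "v $ 2 < 0" | "v $ 2 = 0" by linarith
  then show ?thesis
  proof cases
    case 1
    have "tilt m p < tilt m q" if "q \<in> T - {p}" for q
      using v[OF that] 1 by (simp add: tilt divide_strict_right_mono)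
    then show ?thesis by blast
  next
    case 2
    have "tilt m q < tilt m p" if "q \<in> T - {p}" for q
      using v[OF that] 2 by (simp add: tilt divide_strict_right_mono_neg)
    then show ?thesis by blast
  next
    case 3
    \<comment> \<open>Other points differ from \<open>p\<close> by at least 1 horizontally, while
      heights in the box differ by at most \<open>b\<close>, so slope \<open>b + 1\<close> outweighs
      every height difference.\<close>
    define l where "l = sgn (v $ 1) * (b + 1)"
    have "tilt l q < tilt l p" if q: "q \<in> T - {p}" for q
    proof -
      have *: "v $ 1 * of_int (fst p) < v $ 1 * of_int (fst q)" using v[OF q] 3 by simp
      have bd: "snd q \<le> b" "0 \<le> snd p" using T p(1) q by auto
      then have "b + 1 > 0" using T q by force
      have "1 \<le> sgn (v $ 1) * of_int (fst q - fst p)"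
      proof (cases "v $ 1 > 0")
        case True
        then have "fst p < fst q" using * by simp
        then show ?thesis using True by simp
      next
        case False
        then have "v $ 1 < 0" using * by (cases "v $ 1 = 0") auto
        then have "fst q < fst p" using * by simp
        then show ?thesis using \<open>v $ 1 < 0\<close> by simp
      qed
      then have "(real_of_int b + 1) * 1 \<le> (real_of_int b + 1) * (sgn (v $ 1) * of_int (fst q - fst p))"
        using \<open>b + 1 > 0\<close> by (intro mult_left_mono) auto
      then have "b + 1 \<le> l * of_int (fst q) - l * of_int (fst p)" by (simp add: l_def algebra_simps)
      moreover have "real_of_int (snd q) < real_of_int (snd p) + (b + 1)"
        using bd by linarith
      ultimately show ?thesis unfolding tilt_def by linarith
    qed
    then show ?thesis by blast
  qed
qed

text \<open>A generating subset of least cardinality has no redundant point; it plays the role of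
  the vertex set.\<close>

lemma minimal_generators:
  assumes "finite S"
  obtains T where "T \<subseteq> S" "convex hull (emb ` T) = convex hull (emb ` S)"
    "\<And>p. p \<in> T \<Longrightarrow> emb p \<notin> convex hull (emb ` (T - {p}))"
proof -
  let ?G = "\<lambda>T. T \<subseteq> S \<and> convex hull (emb ` T) = convex hull (emb ` S)"
  obtain T where T: "?G T" and least: "\<forall>T'. ?G T' \<longrightarrow> card T \<le> card T'"
    using ex_has_least_nat[of ?G S card] by blast
  have "emb p \<notin> convex hull (emb ` (T - {p}))" if "p \<in> T" for p
  proof
    assume "emb p \<in> convex hull (emb ` (T - {p}))"
    then have "convex hull (insert (emb p) (emb ` (T - {p}))) = convex hull (emb ` (T - {p}))"
      by (rule hull_redundant)
    moreover have "insert (emb p) (emb ` (T - {p})) = emb ` T" using that by auto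
    ultimately have "?G (T - {p})" using T by auto
    then have "card T \<le> card (T - {p})" using least by blast
    moreover have "finite T" using T assms finite_subset by blast
    ultimately show False using that by (metis card_Diff1_less linorder_not_less)
  qed
  then show ?thesis using T that by blast
qed

text \<open>The vertices exposed from above form \<open>U\<close>, the reflected ones exposed from
  below form \<open>V\<close>. A vertex may occur in both, which is harmless for the hull of the
  union.\<close>

lemma hull_eq_hull_caps:
  assumes S: "S \<subseteq> {0..a} \<times> {0..b}"
  obtains U V where "U \<in> caps a b" "V \<in> caps a b"
    "convex hull (emb ` (U \<union> flip b ` V)) = convex hull (emb ` S)"
proof -
  have "finite S" using S by (auto intro: finite_subset)
  then obtain T where T: "T \<subseteq> S" "convex hull (emb ` T) = convex hull (emb ` S)"
    "\<And>p. p \<in> T \<Longrightarrow> emb p \<notin> convex hull (emb ` (T - {p}))"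
    by (rule minimal_generators) blast
  define U where "U = {p\<in>T. \<exists>l. \<forall>q\<in>T - {p}. tilt l q < tilt l p}"
  define L where "L = {p\<in>T. \<exists>l. \<forall>q\<in>T - {p}. tilt l p < tilt l q}"
  have box: "T \<subseteq> {0..a} \<times> {0..b}" using T S by blast
  have "T = U \<union> L"
    using exposed_above_or_below[OF box _ T(3)] unfolding U_def L_def by blast
  moreover have "flip b ` flip b ` L = L" by (force simp: flip_def image_image)
  moreover have "U \<in> caps a b" using box by (auto simp: caps_def cap_def U_def)
  moreover have "flip b ` L \<in> caps a b"
    unfolding caps_def cap_def
  proof (intro CollectI conjI ballI)
    show "flip b ` L \<subseteq> {0..a} \<times> {0..b}" using box by (auto simp: L_def flip_def)
    fix p' assume "p' \<in> flip b ` L"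
    then obtain p where p: "p \<in> L" "p' = flip b p" by blast
    then obtain l where l: "\<forall>q\<in>T - {p}. tilt l p < tilt l q"
      by (auto simp: L_def)
    have "tilt (- l) q' < tilt (- l) p'" if q': "q' \<in> flip b ` L - {p'}" for q'
    proof -
      obtain q where q: "q \<in> T - {p}" "q' = flip b q" using q' p by (auto simp: L_def)
      with l have "tilt l p < tilt l q" by blast
      then show ?thesis by (simp add: p q flip_def tilt_def)
    qed
    then show "\<exists>l. \<forall>q'\<in>flip b ` L - {p'}. tilt l q' < tilt l p'" by blast
  qed
  ultimately show ?thesis using that T(2) by metis
qed

section \<open>Explicit bounds for the numbers of caps and classes\<close>

lemma card_caps_le_exp:
  assumes ab: "1 \<le> a" "a \<le> b" "real_of_int a * b \<le> n"
  shows "real (card (caps a b)) \<le> 2 * (n + 1) ^ 2 * exp (6 * n powr (1 / 3))"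
proof -
  define A where "A = real_of_int a * b"
  define Y where "Y = A powr (1 / 3)"
  have ge: "1 \<le> real_of_int a" "1 \<le> real_of_int b" using ab by auto
  have aA: "real_of_int a * a \<le> A" unfolding A_def using ab by (intro mult_left_mono) auto
  have A: "1 \<le> A" unfolding A_def using mult_mono[OF ge] ge by simp
  have Y: "1 \<le> Y" unfolding Y_def using A by (intro ge_one_powr_ge_zero) auto
  have Y3: "Y ^ 3 = A"
    unfolding Y_def using A by (simp add: powr_powr flip: powr_realpow)
  have "real_of_int a \<le> Y ^ 2"
  proof (rule power2_le_imp_le)
    have "(real_of_int a)\<^sup>2 \<le> Y ^ 3" using aA Y3 by (simp add: power2_eq_square)
    also have "\<dots> \<le> Y ^ 4" using Y by (intro power_increasing) auto
    finally show "(real_of_int a)\<^sup>2 \<le> (Y ^ 2)\<^sup>2" by simp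
  qed simp
  then have aY: "a / Y \<le> Y" using Y by (simp add: field_simps power2_eq_square)
  \<comment> \<open>The choice \<open>s = Y / a\<close>, \<open>t = Y / b\<close> balances the
    exponent: the terms linear in \<open>s\<close> and \<open>t\<close> give \<open>3 * Y\<close>,
    and \<open>2 / (s * t)\<close> is \<open>2 * A / Y ^ 2 = 2 * Y\<close>. The remaining
    \<open>1 / s = a / Y\<close> is at most \<open>Y\<close> because
    \<open>a \<le> b\<close>.\<close>
  have "card (step_sets a b) \<le>
    exp (Y / a * a + 2 * (Y / b) * b + (1 / (Y / a)) * (1 + 2 / (Y / b)))"
    using Y ge by (intro card_step_sets) auto
  also have "Y / a * a + 2 * (Y / b) * b + (1 / (Y / a)) * (1 + 2 / (Y / b)) = 3 * Y + a / Y + 2 * (A / Y ^ 2)"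
    using Y ge by (simp add: A_def power2_eq_square field_simps)
  also have "A / Y ^ 2 = Y" unfolding Y3[symmetric] using Y by (simp add: power2_eq_square power3_eq_cube)
  also have "exp (3 * Y + a / Y + 2 * Y) \<le> exp (6 * Y)" using aY by simp
  also have "\<dots> \<le> exp (6 * n powr (1 / 3))"
    unfolding Y_def using A ab(3) by (auto simp: A_def intro!: powr_mono2)
  finally have steps: "card (step_sets a b) \<le> exp (6 * n powr (1 / 3))" .
  have "real_of_int a * 1 \<le> real_of_int a * b" using ge by (intro mult_left_mono) auto
  moreover have "1 * real_of_int b \<le> real_of_int a * b" using ge by (intro mult_right_mono) auto
  ultimately have n: "real_of_int a \<le> n" "real_of_int b \<le> n" using ab(3) by auto
  have "card (caps a b) \<le> 1 + nat (a + 1) * nat (b + 1) * card (step_sets a b)"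
    by (rule card_caps) (use ab in auto)
  then have "real (card (caps a b)) \<le> 1 + real (nat (a + 1)) * real (nat (b + 1)) * card (step_sets a b)"
    by (metis of_nat_1 of_nat_add of_nat_le_iff of_nat_mult)
  also have "\<dots> = 1 + (real_of_int a + 1) * (real_of_int b + 1) * card (step_sets a b)" using ab by simp
  also have "\<dots> \<le> 1 + (n + 1) * (n + 1) * exp (6 * n powr (1 / 3))"
    using n ge steps by (intro add_mono mult_mono) auto
  finally have le: "real (card (caps a b)) \<le> 1 + (n + 1) * (n + 1) * exp (6 * n powr (1 / 3))" .
  have "1 * 1 \<le> (n + 1) * (n + 1)" using n ge by (intro mult_mono) auto
  moreover have "1 \<le> exp (6 * n powr (1 / 3))" by simp
  ultimately have "1 * 1 \<le> (n + 1) * (n + 1) * exp (6 * n powr (1 / 3))"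
    by (intro mult_mono) auto
  with le show ?thesis by (simp add: power2_eq_square)
qed

lemma card_UN_square_le:
  assumes "finite I" "\<And>i. i \<in> I \<Longrightarrow> real (card (F i)) \<le> B" "real (card I) \<le> N" "B \<ge> 0"
    "\<And>i. i \<in> I \<Longrightarrow> finite (F i)"
  shows "real (card (\<Union>i\<in>I. G i ` (F i \<times> F i))) \<le> N * B ^ 2"
proof -
  have "card (\<Union>i\<in>I. G i ` (F i \<times> F i)) \<le> (\<Sum>i\<in>I. card (G i ` (F i \<times> F i)))"
    by (rule card_UN_le[OF assms(1)])
  also have "\<dots> \<le> (\<Sum>i\<in>I. card (F i) ^ 2)"
    using assms(5) by (intro sum_mono) (metis card_cartesian_product card_image_le finite_cartesian_product power2_eq_square)
  finally have "real (card (\<Union>i\<in>I. G i ` (F i \<times> F i))) \<le> (\<Sum>i\<in>I. real (card (F i)) ^ 2)"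
    by (simp flip: of_nat_power of_nat_sum)
  also have "\<dots> \<le> (\<Sum>i\<in>I. B ^ 2)" using assms(2) by (intro sum_mono power_mono) auto
  also have "\<dots> \<le> N * B ^ 2" using assms(3,4) by (simp add: mult_right_mono)
  finally show ?thesis .
qed

lemma classes_upper_bound:
  assumes w: "w \<ge> 8"
  defines "Q \<equiv> (polytopes_with_count w :: (real ^ 2) set set) // equivalence_rel w"
  defines "n \<equiv> 32 * real w"
  shows "finite Q" and "real (card Q) \<le> n ^ 2 * (2 * (n + 1) ^ 2 * exp (6 * n powr (1 / 3))) ^ 2"
proof -
  define I where "I = {(a, b). 1 \<le> a \<and> a \<le> b \<and> a * b \<le> 32 * int w}"
  define G where "G = (\<lambda>(a :: int, b) (U, V). U \<union> flip b ` V)"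
  define Ts where "Ts = (\<Union>i\<in>I. G i ` (caps (fst i) (snd i) \<times> caps (fst i) (snd i)))"
  have I: "I \<subseteq> {1..32 * int w} \<times> {1..32 * int w}"
  proof safe
    fix a b assume "(a, b) \<in> I"
    then have ab: "1 \<le> a" "a \<le> b" "a * b \<le> 32 * int w" by (auto simp: I_def)
    then have "a * 1 \<le> a * b" by (intro mult_left_mono) auto
    moreover have "1 * b \<le> a * b" using ab by (intro mult_right_mono) auto
    ultimately have "a \<le> 32 * int w" "b \<le> 32 * int w" using ab(3) by linarith+
    then show "a \<in> {1..32 * int w}" "b \<in> {1..32 * int w}" using ab by auto
  qed
  then have finI: "finite I" by (rule finite_subset) auto
  have "card I \<le> card ({1..32 * int w} \<times> {1..32 * int w})" using I by (intro card_mono) auto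
  then have "card I \<le> (32 * w) * (32 * w)"
    by (simp add: card_cartesian_product nat_mult_distrib)
  then have "real (card I) \<le> real ((32 * w) * (32 * w))" by (simp only: of_nat_le_iff)
  then have cardI: "real (card I) \<le> n ^ 2" by (simp add: n_def power2_eq_square)
  have caps: "real (card (caps (fst i) (snd i))) \<le> 2 * (n + 1) ^ 2 * exp (6 * n powr (1 / 3))" if "i \<in> I" for i
  proof (rule card_caps_le_exp)
    have "fst i * snd i \<le> 32 * int w" using that by (auto simp: I_def)
    then have "real_of_int (fst i * snd i) \<le> of_int (32 * int w)" by (simp only: of_int_le_iff)
    then show "real_of_int (fst i) * real_of_int (snd i) \<le> n" by (simp add: n_def)
  qed (use that in \<open>auto simp: I_def\<close>)
  have bound: "real (card Ts) \<le> n ^ 2 * (2 * (n + 1) ^ 2 * exp (6 * n powr (1 / 3))) ^ 2"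
    unfolding Ts_def using finI caps cardI finite_caps by (intro card_UN_square_le) auto
  have finTs: "finite Ts" unfolding Ts_def using finI finite_caps by auto
  \<comment> \<open>Each class contains the hull of a set from \<open>Ts\<close>. Distinct classes
    are disjoint, so the sets chosen for them differ.\<close>
  have "\<exists>T\<in>Ts. convex hull (emb ` T) \<in> c" if c: "c \<in> Q" for c
  proof -
    obtain P where P: "P \<in> polytopes_with_count w" "c = equivalence_rel w `` {P}"
      using c unfolding Q_def by (rule quotientE)
    obtain P' a b where P': "lattice_equivalent P P'" "1 \<le> a" "a \<le> b" "a * b \<le> 32 * int w"
      "latt P' \<subseteq> {0..a} \<times> {0..b}"
      using small_box_representative[OF P(1) w] by metis
    obtain U V where UV: "U \<in> caps a b" "V \<in> caps a b"
      "convex hull (emb ` (U \<union> flip b ` V)) = convex hull (emb ` latt P')"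
      using hull_eq_hull_caps[OF P'(5)] by metis
    have P'w: "P' \<in> polytopes_with_count w"
      by (rule lattice_equivalent_polytopes_with_count[OF P'(1) P(1)])
    then have "convex hull (emb ` (U \<union> flip b ` V)) = P'"
      using polytopes_with_countD(3)[OF P'w] UV(3) w by simp
    moreover have "P' \<in> c" using P P' P'w by (simp add: equivalence_rel_def)
    moreover have "U \<union> flip b ` V \<in> Ts"
      unfolding Ts_def using UV P' by (intro UN_I[of "(a, b)"] image_eqI[of _ _ "(U, V)"]) (auto simp: I_def G_def)
    ultimately show ?thesis by metis
  qed
  then obtain gen where gen: "\<And>c. c \<in> Q \<Longrightarrow> gen c \<in> Ts \<and> convex hull (emb ` gen c) \<in> c"
    by metis
  have inj: "inj_on gen Q"
  proof (rule inj_onI)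
    fix c d assume *: "c \<in> Q" "d \<in> Q" "gen c = gen d"
    then have "convex hull (emb ` gen c) \<in> c \<inter> d" using gen by fastforce
    moreover have "c = d \<or> c \<inter> d = {}"
      using quotient_disj[OF equiv_equivalence_rel, of c w d] *(1,2) by (simp add: Q_def)
    ultimately show "c = d" by blast
  qed
  have img: "gen ` Q \<subseteq> Ts" using gen by blast
  show "finite Q" using finite_subset[OF img finTs] inj by (rule finite_imageD)
  have "card Q \<le> card Ts" by (rule card_inj_on_le[OF inj img finTs])
  then show "real (card Q) \<le> n ^ 2 * (2 * (n + 1) ^ 2 * exp (6 * n powr (1 / 3))) ^ 2"
    using bound by linarith
qed

section \<open>Polygons inscribed in a parabola\<close>

text \<open>The lattice points between the parabola and height \<open>H\<close>, together with
  \<open>r\<close> points of the next row; \<open>r\<close> serves to tune the cardinality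
  exactly.\<close>

definition body :: "int \<Rightarrow> int \<Rightarrow> int \<Rightarrow> (int \<times> int) set" where
  "body n H r = {(x, y). 0 \<le> x \<and> x \<le> n \<and> x\<^sup>2 \<le> y \<and> (y \<le> H \<or> y = H + 1 \<and> x < r)}"

definition arc :: "int \<Rightarrow> (int \<times> int) set" where
  "arc n = (\<lambda>i. (i, i\<^sup>2)) ` {1..n}"

text \<open>Half-planes are convex. Integer coefficients keep later arguments in \<open>int\<close>,
  where a strict inequality is a weak one shifted by 1.\<close>

lemma hull_linear_le:
  fixes \<alpha> \<beta> \<gamma> :: int
  assumes "emb (x, y) \<in> convex hull (emb ` S)" "\<And>x y. (x, y) \<in> S \<Longrightarrow> \<alpha> * x + \<beta> * y \<le> \<gamma>"
  shows "\<alpha> * x + \<beta> * y \<le> \<gamma>"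
proof -
  define v :: "real ^ 2" where "v = emb (\<alpha>, \<beta>)"
  have v: "v \<bullet> emb (x, y) = of_int (\<alpha> * x + \<beta> * y)" for x y
    by (simp add: v_def inner_vec_def sum_2)
  have "emb ` S \<subseteq> {z. v \<bullet> z \<le> of_int \<gamma>}"
    using assms(2) by (auto simp del: of_int_add of_int_mult simp add: v)
  then have "convex hull (emb ` S) \<subseteq> {z. v \<bullet> z \<le> of_int \<gamma>}"
    by (rule hull_minimal) (rule convex_halfspace_le)
  with assms(1) have "v \<bullet> emb (x, y) \<le> of_int \<gamma>" by blast
  then show ?thesis by (simp only: v of_int_le_iff)
qed

lemma hull_linear_less:
  fixes \<alpha> \<beta> \<gamma> :: int
  assumes "emb (x, y) \<in> convex hull (emb ` S)" "\<And>x y. (x, y) \<in> S \<Longrightarrow> \<alpha> * x + \<beta> * y < \<gamma>"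
  shows "\<alpha> * x + \<beta> * y < \<gamma>"
  using hull_linear_le[of x y S \<alpha> \<beta> "\<gamma> - 1"] assms by force

text \<open>The lattice points of the parabola are vertices, so removing any of them keeps the set
  lattice convex. The oblique inequality cuts off the unused part of the top row.\<close>
lemma latt_hull_body:
  assumes r: "0 \<le> r" "r \<le> n" and E: "E \<subseteq> arc n"
  shows "latt (convex hull (emb ` (body n H r - E))) = body n H r - E"
proof (intro equalityI subsetI)
  fix p assume "p \<in> latt (convex hull (emb ` (body n H r - E)))"
  moreover obtain x y where p: "p = (x, y)" by fastforce
  ultimately have hull: "emb (x, y) \<in> convex hull (emb ` (body n H r - E))" by (simp add: latt_def)
  note le = hull_linear_le[OF hull]
  \<comment> \<open>The body lies above the tangent to the parabola at
    \<open>(i, i\<^sup>2)\<close>.\<close>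
  have parabola: "2 * i * x' + (- 1) * y' \<le> i\<^sup>2" if "(x', y') \<in> body n H r" for i x' y'
  proof -
    have "0 \<le> (x' - i)\<^sup>2" by simp
    then have "2 * i * x' - x'\<^sup>2 \<le> i\<^sup>2" by (simp add: power2_eq_square algebra_simps)
    then show ?thesis using that by (auto simp: body_def)
  qed
  \<comment> \<open>The boundary line passes through \<open>(r - 1, H + 1)\<close> and
    \<open>(n, H)\<close>; in row \<open>H + 1\<close> the inequality reads
    \<open>x' \<le> r - 1\<close>.\<close>
  have oblique: "1 * x' + (n - r + 1) * y' \<le> n + (n - r + 1) * H" if "(x', y') \<in> body n H r" for x' y'
  proof (cases "y' \<le> H")
    case True
    then have "(n - r + 1) * y' \<le> (n - r + 1) * H" using r by (intro mult_left_mono) auto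
    moreover have "x' \<le> n" using that by (auto simp: body_def)
    ultimately show ?thesis by simp
  next
    case False
    then have "y' = H + 1" "x' < r" using that by (auto simp: body_def)
    then show ?thesis by (simp add: algebra_simps)
  qed
  have "(-1) * x + 0 * y \<le> 0" by (rule le) (auto simp: body_def)
  moreover have "1 * x + 0 * y \<le> n" by (rule le) (auto simp: body_def)
  moreover have "2 * x * x + (- 1) * y \<le> x\<^sup>2" by (rule le) (use parabola in blast)
  then have "x\<^sup>2 \<le> y" by (simp add: power2_eq_square)
  moreover have "0 * x + 1 * y \<le> H + 1" by (rule le) (auto simp: body_def)
  moreover have "1 * x + (n - r + 1) * y \<le> n + (n - r + 1) * H" by (rule le) (use oblique in blast)
  moreover have "x < r" if "y = H + 1"
    using that calculation by (simp add: algebra_simps)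
  ultimately have "(x, y) \<in> body n H r" by (force simp: body_def)
  moreover have "(x, y) \<notin> E"
  proof
    assume xy: "(x, y) \<in> E"
    then have y: "y = x\<^sup>2" using E by (auto simp: arc_def)
    \<comment> \<open>The tangent at the removed point touches the body only there, so the
      inequality is strict on the remaining points and hence on their hull.\<close>
    have "2 * x * x + (- 1) * y < x\<^sup>2"
    proof (rule hull_linear_less[OF hull])
      fix x' y' assume *: "(x', y') \<in> body n H r - E"
      then have "x'\<^sup>2 \<le> y'" "x' \<noteq> x \<or> y' \<noteq> y" using xy by (auto simp: body_def)
      then have "0 < (x' - x)\<^sup>2 \<or> x' = x \<and> x'\<^sup>2 < y'" using y by auto
      then have "2 * x * x' - y' < x\<^sup>2"
        using \<open>x'\<^sup>2 \<le> y'\<close> by (auto simp: power2_eq_square algebra_simps)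
      then show "2 * x * x' + (- 1) * y' < x\<^sup>2" by simp
    qed
    then show False by (simp add: y power2_eq_square)
  qed
  ultimately show "p \<in> body n H r - E" using p by simp
qed (auto simp: latt_def intro: hull_inc)

lemma interior_unit_square:
  fixes P :: "(real ^ 2) set"
  assumes "convex P" "emb (0, h) \<in> P" "emb (1, h) \<in> P" "emb (0, h + 1) \<in> P" "emb (1, h + 1) \<in> P"
  shows "interior P \<noteq> {}"
proof -
  let ?B = "box (emb (0, h)) (emb (1, h + 1))"
  have "?B \<subseteq> P"
  proof
    fix z assume "z \<in> ?B"
    then have z: "0 \<le> z $ 1" "z $ 1 \<le> 1" "h \<le> z $ 2" "z $ 2 \<le> h + 1"
      by (auto simp: mem_box_cart forall_2)
    have "vector [0, z $ 2] \<in> P" "vector [1, z $ 2] \<in> P"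
      using assms z by (auto intro!: convex_vertical[of P _ "of_int h" "of_int h + 1"] simp: emb_eq_vector)
    then have "(1 - z $ 1) *\<^sub>R vector [0, z $ 2] + z $ 1 *\<^sub>R vector [1, z $ 2] \<in> P"
      using assms(1) z by (intro convexD_alt)
    also have "(1 - z $ 1) *\<^sub>R vector [0, z $ 2] + z $ 1 *\<^sub>R vector [1, z $ 2] = z"
      by (simp add: vec_eq_iff forall_2 algebra_simps)
    finally show "z \<in> P" .
  qed
  then have "?B \<subseteq> interior P" by (intro interior_maximal open_box)
  moreover have "?B \<noteq> {}" by (simp add: interval_ne_empty_cart forall_2)
  ultimately show ?thesis by blast
qed

lemma card_body:
  assumes "0 \<le> r" "r \<le> n" "n\<^sup>2 \<le> H"
  shows "finite (body n H r)"
    and "int (card (body n H r)) = (n + 1) * (H + 1) + r - (\<Sum>x\<in>{0..n}. x\<^sup>2)"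
proof -
  let ?top = "\<lambda>x. if x < r then H + 1 else H"
  have eq: "body n H r = (SIGMA x:{0..n}. {x\<^sup>2..?top x})"
    by (auto simp: body_def split: if_splits)
  show "finite (body n H r)" unfolding eq by auto
  \<comment> \<open>No column is empty, so its cardinality is the untruncated integer
    difference.\<close>
  have "x\<^sup>2 \<le> H" if "x \<in> {0..n}" for x
    by (rule order_trans[OF power_mono[of x n 2] assms(3)]) (use that in auto)
  then have "int (card (body n H r)) = (\<Sum>x\<in>{0..n}. ?top x + 1 - x\<^sup>2)"
    unfolding eq by (simp add: card_SigmaI) (rule sum.cong; force)
  also have "\<dots> = (\<Sum>x\<in>{0..n}. (H + 1 - x\<^sup>2) + (if x < r then 1 else 0))"
    by (rule sum.cong) auto
  also have "\<dots> = (\<Sum>x\<in>{0..n}. H + 1 - x\<^sup>2) + (\<Sum>x\<in>{0..n}. if x < r then 1 else 0)"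
    by (rule sum.distrib)
  also have "(\<Sum>x\<in>{0..n}. if x < r then 1 else 0 :: int) = (\<Sum>x\<in>{0..<r}. 1)"
    by (rule sum.mono_neutral_cong_right) (use assms in auto)
  also have "\<dots> = r" using assms by simp
  also have "(\<Sum>x\<in>{0..n}. H + 1 - x\<^sup>2) = (n + 1) * (H + 1) - (\<Sum>x\<in>{0..n}. x\<^sup>2)"
    using assms by (simp add: sum_subtractf)
  finally show "int (card (body n H r)) = (n + 1) * (H + 1) + r - (\<Sum>x\<in>{0..n}. x\<^sup>2)" by simp
qed

text \<open>Raising \<open>H\<close> by one adds \<open>n + 1\<close> points, so division with
  remainder by \<open>n + 1\<close> yields both \<open>H\<close> and \<open>r\<close>. The lower
  bound on \<open>W\<close> puts the top of the body above the arc.\<close>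

lemma body_with_card:
  assumes "n \<ge> 0" "(n + 1) * (n\<^sup>2 + 2) \<le> int W"
  obtains H r where "0 \<le> r" "r \<le> n" "n\<^sup>2 + 1 \<le> H" "card (body n H r) = W"
proof -
  define N where "N = int W + (\<Sum>x\<in>{0..n}. x\<^sup>2)"
  define H r where "H = N div (n + 1) - 1" and "r = N mod (n + 1)"
  have N: "N = (n + 1) * (H + 1) + r" by (simp add: H_def r_def)
  have r: "0 \<le> r" "r \<le> n" using assms(1) pos_mod_bound[of "n + 1" N] by (auto simp: r_def)
  have "(n + 1) * (n\<^sup>2 + 2) \<le> N" using assms(2) sum_nonneg[of "{0..n}" "\<lambda>x. x\<^sup>2"] by (simp add: N_def)
  then have "(n\<^sup>2 + 2) * (n + 1) div (n + 1) \<le> N div (n + 1)"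
    using assms(1) by (intro zdiv_mono1) (auto simp: mult.commute)
  then have H: "n\<^sup>2 + 1 \<le> H" using assms(1) by (simp add: H_def)
  then have "int (card (body n H r)) = W"
    using card_body(2)[OF r, of H] N by (simp add: N_def)
  then show ?thesis using r H that by simp
qed

section \<open>The number of members of the family in one class\<close>

text \<open>The three points form an affine basis of the plane, so an affine map is determined by
  their images.\<close>

lemma affine_eq_of_three:
  assumes "affine_transformation \<sigma>"
  shows "\<sigma> z = \<sigma> (emb (0, h)) + z $ 1 *\<^sub>R (\<sigma> (emb (1, h)) - \<sigma> (emb (0, h)))
    + (z $ 2 - h) *\<^sub>R (\<sigma> (emb (0, h + 1)) - \<sigma> (emb (0, h)))"
proof -
  obtain A b where \<sigma>: "\<sigma> = (\<lambda>x. A *v x + b)"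
    using assms by (auto simp: affine_transformation_def)
  have "z = emb (0, h) + z $ 1 *\<^sub>R (emb (1, h) - emb (0, h)) + (z $ 2 - h) *\<^sub>R (emb (0, h + 1) - emb (0, h))"
    by (simp add: vec_eq_iff forall_2)
  then have "A *v z = A *v \<dots>" by (rule arg_cong)
  also have "\<dots> = A *v emb (0, h) + z $ 1 *\<^sub>R (A *v emb (1, h) - A *v emb (0, h))
      + (z $ 2 - h) *\<^sub>R (A *v emb (0, h + 1) - A *v emb (0, h))"
    by (simp only: linear_add[OF matrix_vector_mul_linear] linear_diff[OF matrix_vector_mul_linear]
        linear_scale[OF matrix_vector_mul_linear])
  finally show ?thesis by (simp add: \<sigma>)
qed

text \<open>A member of the family equivalent to a fixed one is determined by where the equivalence sends
  three fixed lattice points, all of which land in the body.\<close>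
lemma classes_lower_bound:
  fixes w k :: nat
  assumes "k > 0" "(2 * k + 1) * (4 * k\<^sup>2 + 2) \<le> w"
  defines "Q \<equiv> (polytopes_with_count w :: (real ^ 2) set set) // equivalence_rel w"
  assumes finQ: "finite Q"
  shows "(2 * k) choose k \<le> card Q * (w + k) ^ 3"
proof -
  let ?n = "2 * int k"
  have "int ((2 * k + 1) * (4 * k\<^sup>2 + 2)) \<le> int (w + k)" using assms(2) by linarith
  then have W: "(?n + 1) * (?n\<^sup>2 + 2) \<le> int (w + k)" by (simp add: power2_eq_square algebra_simps)
  have "0 \<le> ?n" by simp
  then obtain H r where r: "0 \<le> r" "r \<le> ?n" and H: "?n\<^sup>2 + 1 \<le> H" and card: "card (body ?n H r) = w + k"
    by (rule body_with_card[OF _ W])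
  define B where "B = body ?n H r"
  have finB: "finite B" unfolding B_def using r H by (intro card_body) auto
  have arcB: "arc ?n \<subseteq> B"
  proof
    fix p assume "p \<in> arc ?n"
    then obtain i where i: "1 \<le> i" "i \<le> ?n" "p = (i, i\<^sup>2)" by (auto simp: arc_def)
    then have "i\<^sup>2 \<le> ?n\<^sup>2" by (intro power_mono) auto
    then show "p \<in> B" using i H by (auto simp: B_def body_def)
  qed
  define Fam where "Fam = {E. E \<subseteq> arc ?n \<and> card E = k}"
  define poly where "poly E = convex hull (emb ` (B - E))" for E
  have "finite (arc ?n)" using arcB finB by (rule finite_subset)
  moreover have "card (arc ?n) = 2 * k" unfolding arc_def by (subst card_image) (auto simp: inj_on_def)
  ultimately have cardFam: "card Fam = (2 * k) choose k" and finFam: "finite Fam"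
    using n_subsets[of "arc ?n" k] by (auto simp: Fam_def)
  have latt: "latt (poly E) = B - E" if "E \<in> Fam" for E
    unfolding poly_def B_def using that r by (intro latt_hull_body) (auto simp: Fam_def)
  \<comment> \<open>The unit square over columns 0 and 1 between heights \<open>H - 1\<close> and
    \<open>H\<close> avoids the arc, so it survives every removal. It provides an interior point and
    the three reference points.\<close>
  define h where "h = H - 1"
  have "0 < ?n\<^sup>2" using \<open>k > 0\<close> by simp
  then have h: "1 \<le> h" using H unfolding h_def by linarith
  have corners: "(0, h) \<in> B - E" "(1, h) \<in> B - E" "(0, h + 1) \<in> B - E" "(1, h + 1) \<in> B - E"
    if "E \<in> Fam" for E
  proof -
    have "2\<^sup>2 \<le> ?n\<^sup>2" by (intro power_mono) (use \<open>k > 0\<close> in auto)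
    then have "(0, h) \<notin> arc ?n" "(1, h) \<notin> arc ?n" "(0, h + 1) \<notin> arc ?n" "(1, h + 1) \<notin> arc ?n"
      using H by (auto simp: arc_def h_def)
    moreover have "(0, h) \<in> B" "(1, h) \<in> B" "(0, h + 1) \<in> B" "(1, h + 1) \<in> B"
      using \<open>k > 0\<close> h by (auto simp: B_def body_def h_def)
    ultimately show "(0, h) \<in> B - E" "(1, h) \<in> B - E" "(0, h + 1) \<in> B - E" "(1, h + 1) \<in> B - E"
      using that by (auto simp: Fam_def)
  qed
  have poly: "poly E \<in> polytopes_with_count w" if E: "E \<in> Fam" for E
  proof -
    have "interior (poly E) \<noteq> {}"
      by (rule interior_unit_square[of _ h])
         (use corners[OF E] in \<open>auto simp: poly_def intro!: hull_inc\<close>)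
    moreover have "lattice_polytope (poly E)"
      unfolding lattice_polytope_def poly_def
      using finB by (intro exI[of _ "emb ` (B - E)"]) (auto simp: int_lattice_eq)
    moreover have "card (B - E) = w"
      using E finB arcB card by (subst card_Diff_subset) (auto simp: Fam_def B_def intro: finite_subset)
    then have "lattice_count (poly E) = w" by (simp add: lattice_count_eq latt[OF E])
    ultimately show ?thesis by (simp add: polytopes_with_count_def full_dimensional_def)
  qed
  define cls where "cls E = equivalence_rel w `` {poly E}" for E
  have fiber: "card {E \<in> Fam. cls E = c} \<le> (w + k) ^ 3" for c
  proof (cases "{E \<in> Fam. cls E = c} = {}")
    case False
    then obtain E0 where E0: "E0 \<in> Fam" "cls E0 = c" by blast
    have "\<exists>\<sigma>. affine_transformation \<sigma> \<and> \<sigma> ` int_lattice = int_lattice \<and> \<sigma> ` poly E0 = poly E"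
      if "E \<in> Fam" "cls E = c" for E
    proof -
      have "(poly E0, poly E) \<in> equivalence_rel w"
        using eq_equiv_class[OF _ equiv_equivalence_rel poly[OF that(1)]] that(2) E0(2)
        unfolding cls_def by metis
      then show ?thesis by (simp add: equivalence_rel_def lattice_equivalent_def)
    qed
    then obtain \<sigma> where \<sigma>: "\<And>E. E \<in> {E \<in> Fam. cls E = c} \<Longrightarrow> affine_transformation (\<sigma> E) \<and>
        \<sigma> E ` int_lattice = int_lattice \<and> \<sigma> E ` poly E0 = poly E"
      by (metis (mono_tags, lifting) mem_Collect_eq)
    \<comment> \<open>For \<open>E\<close> in one class with \<open>E0\<close>, the map
      \<open>\<sigma> E\<close> and thus \<open>E\<close> itself can be recovered from this triple.
      Its entries are lattice points of \<open>poly E\<close>, which leaves at most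
      \<open>(w + k) ^ 3\<close> values.\<close>
    define g where "g E = (\<sigma> E (emb (0, h)), \<sigma> E (emb (1, h)), \<sigma> E (emb (0, h + 1)))" for E
    have "inj_on g {E \<in> Fam. cls E = c}"
    proof (rule inj_onI)
      fix E E' assume E: "E \<in> {E \<in> Fam. cls E = c}" "E' \<in> {E \<in> Fam. cls E = c}" "g E = g E'"
      have "\<sigma> E z = \<sigma> E' z" for z
        using affine_eq_of_three[of "\<sigma> E" z h] affine_eq_of_three[of "\<sigma> E'" z h] \<sigma>[OF E(1)] \<sigma>[OF E(2)] E(3)
        by (simp add: g_def)
      then have "\<sigma> E ` poly E0 = \<sigma> E' ` poly E0" by simp
      then have "poly E = poly E'" using \<sigma>[OF E(1)] \<sigma>[OF E(2)] by simp
      then have "B - E = B - E'" using latt E(1,2) by (metis (mono_tags, lifting) mem_Collect_eq)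
      moreover have "E \<subseteq> B" "E' \<subseteq> B" using E(1,2) arcB by (auto simp: Fam_def)
      ultimately show "E = E'" by blast
    qed
    moreover have "g ` {E \<in> Fam. cls E = c} \<subseteq> (emb ` B) \<times> (emb ` B) \<times> (emb ` B)"
    proof (rule image_subsetI)
      fix E assume E: "E \<in> {E \<in> Fam. cls E = c}"
      have "\<sigma> E (emb p) \<in> emb ` B" if "p \<in> B - E0" for p
      proof -
        have "emb p \<in> poly E0 \<inter> int_lattice"
          using that latt[OF E0(1)] Int_int_lattice[of "poly E0"] by auto
        then have "\<sigma> E (emb p) \<in> poly E \<inter> int_lattice" using \<sigma>[OF E] by blast
        then show ?thesis using latt[of E] E Int_int_lattice[of "poly E"] by auto
      qed
      then show "g E \<in> (emb ` B) \<times> (emb ` B) \<times> (emb ` B)" using corners[OF E0(1)] by (simp add: g_def)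
    qed
    ultimately have "card {E \<in> Fam. cls E = c} \<le> card ((emb ` B) \<times> (emb ` B) \<times> (emb ` B))"
      using finB by (intro card_inj_on_le) auto
    also have "\<dots> = (w + k) ^ 3"
      using card by (simp add: card_cartesian_product card_image inj_on_subset[OF inj_emb] power3_eq_cube B_def)
    finally show ?thesis .
  next
    case True
    then show ?thesis by (simp only: card.empty)
  qed
  have "cls ` Fam \<subseteq> Q" unfolding cls_def Q_def using poly by (auto intro: quotientI)
  have "Fam = (\<Union>c\<in>cls ` Fam. {E \<in> Fam. cls E = c})" by auto
  then have "card Fam \<le> (\<Sum>c\<in>cls ` Fam. card {E \<in> Fam. cls E = c})"
    using card_UN_le[of "cls ` Fam" "\<lambda>c. {E \<in> Fam. cls E = c}"] finFam by simp
  also have "\<dots> \<le> (\<Sum>c\<in>cls ` Fam. (w + k) ^ 3)" by (intro sum_mono fiber)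
  also have "\<dots> \<le> card Q * (w + k) ^ 3"
    using card_mono[OF finQ \<open>cls ` Fam \<subseteq> Q\<close>] by simp
  finally show ?thesis by (simp add: cardFam)
qed

section \<open>The growth of the number of classes\<close>

theorem theorem2:
  shows "\<exists>(c1::real) (c2::real) (w0::nat). c1 > 0 \<and> c2 > 0 \<and> w0 > 0 \<and>
           (\<forall>w::nat. w \<ge> w0 \<longrightarrow>
              c1 * real w powr (1/3) \<le> ln (real (kappa TYPE(2) w)) \<and>
              ln (real (kappa TYPE(2) w)) \<le> c2 * real w powr (1/3))"
proof -
  \<comment> \<open>In order: polynomial factors of the upper bound are absorbed, those of the lower
    bound are absorbed, the parabola fits into \<open>w\<close> points, \<open>k\<close> is
    positive, and \<open>classes_upper_bound\<close> applies.\<close>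
  have "\<forall>\<^sub>F w :: nat in sequentially.
      2 * ln 2 + 2 * ln (32 * real w) + 4 * ln (32 * real w + 1) \<le> real w powr (1/3) \<and>
      real w powr (1/3) / 16 \<le> (real w powr (1/3) / 4 - 1) * (2 / 3) - 3 * ln (2 * real w) \<and>
      (real w powr (1/3) / 2 + 1) * ((real w powr (1/3))\<^sup>2 / 4 + 2) \<le> real w \<and>
      4 \<le> real w powr (1/3) \<and> 8 \<le> w"
    by (intro eventually_conj; real_asymp)
  then obtain w0 where w0: "\<And>w. w \<ge> w0 \<Longrightarrow>
      2 * ln 2 + 2 * ln (32 * real w) + 4 * ln (32 * real w + 1) \<le> real w powr (1/3) \<and>
      real w powr (1/3) / 16 \<le> (real w powr (1/3) / 4 - 1) * (2 / 3) - 3 * ln (2 * real w) \<and>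
      (real w powr (1/3) / 2 + 1) * ((real w powr (1/3))\<^sup>2 / 4 + 2) \<le> real w \<and>
      4 \<le> real w powr (1/3) \<and> 8 \<le> w"
    by (auto simp: eventually_at_top_linorder)
  have "1 / 16 * real w powr (1/3) \<le> ln (real (kappa TYPE(2) w)) \<and>
      ln (real (kappa TYPE(2) w)) \<le> 49 * real w powr (1/3)" if "w \<ge> w0" for w
  proof
    define y where "y = real w powr (1/3)"
    define \<kappa> where "\<kappa> = kappa TYPE(2) w"
    have up: "2 * ln 2 + 2 * ln (32 * real w) + 4 * ln (32 * real w + 1) \<le> y"
      and low: "y / 16 \<le> (y / 4 - 1) * (2 / 3) - 3 * ln (2 * real w)"
      and size: "(y / 2 + 1) * (y\<^sup>2 / 4 + 2) \<le> real w" and y: "4 \<le> y" and w: "8 \<le> w"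
      using w0[OF that] by (auto simp: y_def)
    note bound = classes_upper_bound[OF w]
    define k where "k = nat \<lfloor>y / 4\<rfloor>"
    have k: "k > 0" "real k \<le> y / 4" "y / 4 - 1 \<le> real k" using y by (auto simp: k_def) linarith+
    have "(2 * real k + 1) * (4 * (real k)\<^sup>2 + 2) \<le> (y / 2 + 1) * (y\<^sup>2 / 4 + 2)"
    proof (intro mult_mono add_mono order_refl)
      have "(2 * real k)\<^sup>2 \<le> (y / 2)\<^sup>2" using k by (intro power_mono) auto
      then show "4 * (real k)\<^sup>2 \<le> y\<^sup>2 / 4" by (simp add: power_mult_distrib power_divide)
    qed (use k y in auto)
    also have "\<dots> \<le> real w" by (rule size)
    finally have "real ((2 * k + 1) * (4 * k\<^sup>2 + 2)) \<le> real w" by (simp add: algebra_simps)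
    then have size': "(2 * k + 1) * (4 * k\<^sup>2 + 2) \<le> w" by (simp only: of_nat_le_iff)
    then have "k \<le> w" by (simp add: algebra_simps)
    \<comment> \<open>The binomial coefficient is at least \<open>(2 * k / k) ^ k\<close>.\<close>
    have "2 ^ k \<le> real ((2 * k) choose k)"
      using binomial_ge_n_over_k_pow_k[of k "2 * k", where ?'a = real] k(1) by simp
    also have "\<dots> \<le> real (\<kappa> * (w + k) ^ 3)"
      using classes_lower_bound[OF k(1) size' bound(1)] by (simp add: \<kappa>_def kappa_def del: of_nat_mult of_nat_power)
    also have "\<dots> = \<kappa> * (real w + real k) ^ 3" by simp
    also have "\<dots> \<le> \<kappa> * (2 * real w) ^ 3"
      using \<open>k \<le> w\<close> by (intro mult_left_mono power_mono) auto
    finally have pow: "2 ^ k \<le> \<kappa> * (2 * real w) ^ 3" .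
    \<comment> \<open>This rules out the default value \<open>ln 0 = 0\<close> before logarithms are
      taken.\<close>
    have "\<kappa> > 0"
    proof (rule ccontr)
      assume "\<not> \<kappa> > 0"
      then have "(2::real) ^ k \<le> 0" using pow by simp
      moreover have "(0::real) < 2 ^ k" by simp
      ultimately show False by linarith
    qed
    have "ln ((2::real) ^ k) \<le> ln (\<kappa> * (2 * real w) ^ 3)" using pow \<open>\<kappa> > 0\<close> w by (subst ln_le_cancel_iff) auto
    also have "\<dots> = ln \<kappa> + ln ((2 * real w) ^ 3)" using \<open>\<kappa> > 0\<close> w by (subst ln_mult_pos) auto
    finally have "k * ln 2 \<le> ln \<kappa> + 3 * ln (2 * real w)"
      using w by (simp only: ln_realpow)
    moreover have "(y / 4 - 1) * (2 / 3) \<le> k * ln (2::real)"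
      using k y ln2_ge_two_thirds by (intro mult_mono) auto
    ultimately show "1 / 16 * y \<le> ln (real \<kappa>)" using low by linarith
    define n where "n = 32 * real w"
    have "n > 0" using w by (simp add: n_def)
    define Z where "Z = 2 * (n + 1) ^ 2 * exp (6 * n powr (1 / 3))"
    have "Z > 0" using \<open>n > 0\<close> by (simp add: Z_def)
    have "real \<kappa> \<le> n ^ 2 * Z ^ 2"
      using bound(2) by (simp add: \<kappa>_def kappa_def n_def Z_def)
    then have "ln (real \<kappa>) \<le> ln (n ^ 2 * Z ^ 2)"
      using \<open>\<kappa> > 0\<close> by (intro ln_mono) auto
    also have "\<dots> = 2 * ln n + 2 * ln Z"
      using \<open>n > 0\<close> \<open>Z > 0\<close> by (simp add: ln_mult ln_realpow)
    also have "ln Z = ln 2 + 2 * ln (n + 1) + 6 * n powr (1 / 3)"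
      using \<open>n > 0\<close> by (simp add: Z_def ln_mult ln_realpow)
    \<comment> \<open>Rounding 32 up to the cube 64 gives \<open>4 * y\<close>. The factor 12 then
      yields \<open>48 * y\<close>, and the logarithmic terms add at most one more \<open>y\<close>,
      whence 49.\<close>
    also have "n powr (1 / 3) \<le> (64 * real w) powr (1 / 3)"
      unfolding n_def by (intro powr_mono2) auto
    also have "(64 * real w) powr (1 / 3) = 4 * y"
    proof -
      have "(64 :: real) powr (1 / 3) = (4 powr 3) powr (1 / 3)" by simp
      also have "\<dots> = 4" by (simp only: powr_powr) simp
      finally show ?thesis by (simp add: y_def powr_mult)
    qed
    finally show "ln (real \<kappa>) \<le> 49 * y" using up by (simp add: n_def)
  qed
  then show ?thesis
    by (intro exI[of _ "1 / 16"] exI[of _ 49] exI[of _ "max 1 w0"]) auto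
qed

end
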